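(* Let $\mathcal T_0$ be an initial AMP marked mesh, $p\ge2$, $K\in\mathcal U_p$, and $i\in\{1,2\}$, and let $\mu_1(K),\mu_2(K)$ be the marked edges of the two nonrefinement faces of $K$. With classes taken relative to $\mathcal U_{p-1}$, the possible ordered pairs $(\operatorname{cls}(\mu_i(K)),\operatorname{cls}(e(K)))$ are exactly $$(H,H),\ (H,V),\ (V,V),\ (M_{\mathrm f},H),\ (M_{\mathrm f},V),\ (I_A,V).$$ For $H\to H$, $H\to V$ and $V\to V$, the anchor is preserved: $\alpha(\mu_i(K))=\alpha(e(K))$.
   Context: **Notation.** Tetrahedra are closed and nondegenerate in $\mathbb R^3$; $[v_0,v_1,\dots]$ is the convex hull; $\mathcal V(X),\mathcal E(X),\mathcal F(X)$ are the sets of vertices, edges, triangular faces of a tetrahedron or mesh $X$; $\operatorname{mid}(e)$ is the midpoint of $e$. **Marked tetrahedron.** A tetrahedron $K$ with a refinement edge $e(K)\in\mathcal E(K)$, a marked edge $\mu_F\in\mathcal E(F)$ for every $F\in\mathcal F(K)$, and a Boolean flag, such that the two faces containing $e(K)$ (refinement faces) have mark $e(K)$; the flag may be set only if the four face marks are coplanar. The other two faces are the nonrefinement faces. Types: $P$ if all face marks are coplanar ($P_u$ flag unset, $P_f$ flag set); $A$ if the marks of both nonrefinement faces meet $e(K)$ but the four marks are not coplanar; $O$ if neither of these two marks meets $e(K)$; $M$ if exactly one does. **Bisection.** For $K=[v_0,v_1,v_2,v_3]$ with $e(K)=[v_0,v_1]$ and $m=\operatorname{mid}([v_0,v_1])$,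 the children are $K_0=[v_0,m,v_2,v_3]$ and $K_1=[m,v_1,v_2,v_3]$, marked as follows: (B1) the inherited face of a child (a face of $K$) keeps its mark, and this mark is the refinement edge of the child; (B2) a cut face (a proper subtriangle of a face of $K$) is marked by its edge opposite $m$; (B3) the common new face $[m,v_2,v_3]$ is marked by $[v_2,v_3]$, except if $K$ has type $P_f$, when it is marked by $[m,w]$ with $w\in\{v_2,v_3\}$ the common old endpoint of the two child refinement edges; (B4) the child flags are set iff $K$ has type $P_u$. **Meshes.** A tetrahedral mesh of a polyhedral domain is a finite collection of tetrahedra with pairwise disjoint interiors whose union is the closure of the domain. It is conforming if two distinct elements intersect in the empty set, a common vertex, edge or face; an AMP marked mesh (mesh of marked tetrahedra) is conformingly marked if it is conforming and any shared face gets the same mark from both sides. An *initial AMP marked mesh* $\mathcal T_0$ is a finite conformingly marked AMP mesh with all flags unset. $\mathcal U_q$ is the mesh obtained by bisecting uniformly $3q$ times every element of $\mathcal T_0$. Known facts: each $\mathcal U_q$ is conformingly marked and unflagged; for $q\ge1$ its elements are of type $A$ or $P_u$. **Edge classes.** Let $p\ge2$ and $e\in\mathcal E(\mathcal U_p)$; classes are relative to $\mathcal U_{p-1}$. With $K'\in\mathcal U_{p-1}$ and $m_{ab}=\operatorname{mid}([a,b])$ for $[a,b]\in\mathcal E(K')$, $\operatorname{cls}(e)$ is: $H$ if $e=[a,m_{ab}]$ or $[b,m_{ab}]$ for an edge $[a,b]$ of $K'$; $V$ if $e=[c,m_{ab}]$ where the face $[a,b,c]$ of $K'$ is marked by $[a,b]$;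 $M_{\mathrm f}$ if $e=[m_{ab},m_{ac}]$ or $[m_{ab},m_{bc}]$ where the face $[a,b,c]$ of $K'$ is marked by $[a,b]$; $I_A$ (resp. $I_P$) if $e$ joins the midpoint of the refinement edge of $K'$ to the midpoint of the opposite edge and $K'$ is of type $A$ (resp. $P_u$). Every $e\in\mathcal E(\mathcal U_p)$ has exactly one class. For an $H$- or $V$-edge, the anchor $\alpha(e)$ is its unique endpoint that is a vertex of $\mathcal U_{p-1}$. "$X\to Y$" abbreviates $\operatorname{cls}(\mu_i(K))=X$ and $\operatorname{cls}(e(K))=Y$. *)

theory Defs
  imports "HOL-Analysis.Analysis"
begin

text \<open>
  Vertices, edges, triangular faces and tetrahedra are represented by their sets of vertices;
  the geometric object is the convex hull of that set.
\<close>

type_synonym point = "real ^ 3"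

definition edges :: "point set \<Rightarrow> point set set" where
  "edges X = {e. e \<subseteq> X \<and> card e = 2}"

definition faces :: "point set \<Rightarrow> point set set" where
  "faces X = {F. F \<subseteq> X \<and> card F = 3}"

definition mid :: "point set \<Rightarrow> point" where
  "mid e = (\<Sum>x\<in>e. x) /\<^sub>R 2"

lemma mid_pair: "a \<noteq> b \<Longrightarrow> mid {a, b} = midpoint a b"
  by (simp add: mid_def midpoint_def)


section \<open>Marked tetrahedra\<close>

text \<open>Only the values of \<open>mark\<close> on the four faces of the tetrahedron are meaningful.\<close>

record marked_tet =
  verts :: "point set"
  refedge :: "point set"
  mark :: "point set \<Rightarrow> point set"
  flag :: bool

definition tet :: "marked_tet \<Rightarrow> point set" where
  "tet K = convex hull verts K"

definition coplanar_marks :: "marked_tet \<Rightarrow> bool" where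
  "coplanar_marks K \<longleftrightarrow> coplanar (\<Union>F\<in>faces (verts K). mark K F)"

definition marked_tetrahedron :: "marked_tet \<Rightarrow> bool" where
  "marked_tetrahedron K \<longleftrightarrow>
     card (verts K) = 4 \<and> \<not> affine_dependent (verts K) \<and>
     refedge K \<in> edges (verts K) \<and>
     (\<forall>F\<in>faces (verts K). mark K F \<in> edges F) \<and>
     (\<forall>F\<in>faces (verts K). refedge K \<subseteq> F \<longrightarrow> mark K F = refedge K) \<and>
     (flag K \<longrightarrow> coplanar_marks K)"

definition nonref_faces :: "marked_tet \<Rightarrow> point set set" where
  "nonref_faces K = {F \<in> faces (verts K). \<not> refedge K \<subseteq> F}"

definition type_Pu :: "marked_tet \<Rightarrow> bool" where
  "type_Pu K \<longleftrightarrow> coplanar_marks K \<and> \<not> flag K"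

definition type_Pf :: "marked_tet \<Rightarrow> bool" where
  "type_Pf K \<longleftrightarrow> coplanar_marks K \<and> flag K"

text \<open>Two edges of a tetrahedron meet iff they share a vertex.\<close>

definition type_A :: "marked_tet \<Rightarrow> bool" where
  "type_A K \<longleftrightarrow>
     (\<forall>F\<in>nonref_faces K. mark K F \<inter> refedge K \<noteq> {}) \<and> \<not> coplanar_marks K"


section \<open>Bisection\<close>

definition new_vertex :: "marked_tet \<Rightarrow> point" where
  "new_vertex K = mid (refedge K)"

definition new_face :: "marked_tet \<Rightarrow> point set" where
  "new_face K = insert (new_vertex K) (verts K - refedge K)"

text \<open>The face of \<open>K\<close> inherited by the child that contains the endpoint \<open>v\<close> of the refinement edge.\<close>

definition inherited_face :: "marked_tet \<Rightarrow> point \<Rightarrow> point set" where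
  "inherited_face K v = verts K - (refedge K - {v})"

definition common_old_endpoint :: "marked_tet \<Rightarrow> point" where
  "common_old_endpoint K =
     (THE w. w \<in> verts K - refedge K \<and> (\<forall>v\<in>refedge K. w \<in> mark K (inherited_face K v)))"

definition new_face_mark :: "marked_tet \<Rightarrow> point set" where
  "new_face_mark K =
     (if type_Pf K then {new_vertex K, common_old_endpoint K} else verts K - refedge K)"

text \<open>
  In \<open>child K v\<close> the faces other than the inherited and the new one are the two cut faces; they
  contain the new vertex, and removing it leaves the opposite edge.
\<close>

definition child :: "marked_tet \<Rightarrow> point \<Rightarrow> marked_tet" where
  "child K v =
     \<lparr> verts = insert (new_vertex K) (inherited_face K v),
       refedge = mark K (inherited_face K v),
       mark = (\<lambda>F. if F = inherited_face K v then mark K F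
                   else if F = new_face K then new_face_mark K
                   else F - {new_vertex K}),
       flag = type_Pu K \<rparr>"

definition children :: "marked_tet \<Rightarrow> marked_tet set" where
  "children K = child K ` refedge K"

definition bisect_all :: "marked_tet set \<Rightarrow> marked_tet set" where
  "bisect_all T = (\<Union>K\<in>T. children K)"


section \<open>Meshes\<close>

definition polyhedral_domain :: "point set \<Rightarrow> bool" where
  "polyhedral_domain D \<longleftrightarrow>
     open D \<and> connected D \<and> bounded D \<and> D \<noteq> {} \<and>
     (\<exists>\<P>. finite \<P> \<and> (\<forall>S\<in>\<P>. polytope S) \<and> frontier D = \<Union>\<P>)"

definition marked_mesh :: "point set \<Rightarrow> marked_tet set \<Rightarrow> bool" where
  "marked_mesh D T \<longleftrightarrow>
     finite T \<and> (\<forall>K\<in>T. marked_tetrahedron K) \<and>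
     (\<forall>K\<in>T. \<forall>L\<in>T. K \<noteq> L \<longrightarrow> interior (tet K) \<inter> interior (tet L) = {}) \<and>
     (\<Union>K\<in>T. tet K) = closure D"

text \<open>\<open>S\<close> below spans the empty set, a common vertex, a common edge or a common face.\<close>

definition conforming :: "marked_tet set \<Rightarrow> bool" where
  "conforming T \<longleftrightarrow>
     (\<forall>K\<in>T. \<forall>L\<in>T. K \<noteq> L \<longrightarrow>
        (\<exists>S. S \<subseteq> verts K \<inter> verts L \<and> card S \<le> 3 \<and> tet K \<inter> tet L = convex hull S))"

definition conformingly_marked :: "marked_tet set \<Rightarrow> bool" where
  "conformingly_marked T \<longleftrightarrow>
     conforming T \<and>
     (\<forall>K\<in>T. \<forall>L\<in>T. \<forall>F \<in> faces (verts K) \<inter> faces (verts L). mark K F = mark L F)"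

definition initial_mesh :: "marked_tet set \<Rightarrow> bool" where
  "initial_mesh T \<longleftrightarrow>
     (\<exists>D. polyhedral_domain D \<and> marked_mesh D T) \<and>
     conformingly_marked T \<and> (\<forall>K\<in>T. \<not> flag K)"

definition uniform_mesh :: "marked_tet set \<Rightarrow> nat \<Rightarrow> marked_tet set" where
  "uniform_mesh T0 q = (bisect_all ^^ (3 * q)) T0"


section \<open>Edge classes\<close>

datatype edge_class = cH | cV | cMf | cIA | cIP

text \<open>
  \<open>has_class T e c\<close>: the edge \<open>e\<close> of the three times uniformly bisected mesh \<open>T\<close> has class \<open>c\<close>
  relative to \<open>T\<close>. The formulas range over all orderings of the vertices, so exchanging \<open>a\<close>
  and \<open>b\<close> covers the second alternative in the classes \<open>cH\<close> and \<open>cMf\<close>.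
\<close>

fun has_class :: "marked_tet set \<Rightarrow> point set \<Rightarrow> edge_class \<Rightarrow> bool" where
  "has_class T e cH \<longleftrightarrow>
     (\<exists>K\<in>T. \<exists>a b. {a, b} \<in> edges (verts K) \<and> e = {a, midpoint a b})"
| "has_class T e cV \<longleftrightarrow>
     (\<exists>K\<in>T. \<exists>a b c. {a, b, c} \<in> faces (verts K) \<and> mark K {a, b, c} = {a, b} \<and>
        e = {c, midpoint a b})"
| "has_class T e cMf \<longleftrightarrow>
     (\<exists>K\<in>T. \<exists>a b c. {a, b, c} \<in> faces (verts K) \<and> mark K {a, b, c} = {a, b} \<and>
        e = {midpoint a b, midpoint a c})"
| "has_class T e cIA \<longleftrightarrow>
     (\<exists>K\<in>T. type_A K \<and> e = {mid (refedge K), mid (verts K - refedge K)})"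
| "has_class T e cIP \<longleftrightarrow>
     (\<exists>K\<in>T. type_Pu K \<and> e = {mid (refedge K), mid (verts K - refedge K)})"

definition cls :: "marked_tet set \<Rightarrow> point set \<Rightarrow> edge_class" where
  "cls T e = (THE c. has_class T e c)"

text \<open>Meaningful for edges of class \<open>cH\<close> or \<open>cV\<close> only.\<close>

definition anchor :: "marked_tet set \<Rightarrow> point set \<Rightarrow> point" where
  "anchor T e = (THE x. x \<in> e \<and> x \<in> (\<Union>K\<in>T. verts K))"

end

theory Submission
  imports Defs
begin

text \<open>
  Bisecting an unflagged tetrahedron three times splits three of its edges, and with the vertices
  named suitably a single pattern (locale \<open>thrice\<close>) describes all descendants, so their marks and
  the classes of these marks can be read off; midpoints become vertices only one level later, which
  gives the anchors. That an edge has only one class rests on conformity of the uniform meshes. This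
  is expressed by uniqueness of barycentric coordinates across the whole mesh
  (\<open>admissible\<close>), which survives three bisections because the barycentric coordinates with respect
  to a descendant depend only on those with respect to \<open>K\<close> and on the marks of the faces carrying
  the point. For the existence part, one tetrahedron of type \<open>A\<close> suffices: its descendants after
  three bisections are again of type \<open>A\<close>, and they realise all six pairs.
\<close>

section \<open>Children of a tetrahedron\<close>

text \<open>The induction cannot go one bisection at a time: a face that contains the refinement
  edge of one neighbour but not of the other is halved on one side only, so conformity can fail
  after one or two steps. Only after three steps is every face cut into four by a common rule,
  through the midpoint of its marked edge, and only then are all flags certain to be unset again.
  Two descendants of elements of the mesh need comparing only where their histories part: distinct
  elements share at most a face, and the two children of a common ancestor share only its new face.
  Marks are compared at the barycenter of a common face, where every vertex of that face has
  positive weight. Separating \<open>cIA\<close> from \<open>cIP\<close> takes more than conformity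
  of the point sets, namely that an element is determined by its vertices; this is why the invariant
  also speaks about equality of elements.\<close>

lemma affine_independent_four:
  fixes a b c d :: point
  assumes "distinct [a, b, c, d]"
  shows "\<not> affine_dependent {a, b, c, d} \<longleftrightarrow>
    (\<forall>p q r s. p + q + r + s = 0 \<and> p *\<^sub>R a + q *\<^sub>R b + r *\<^sub>R c + s *\<^sub>R d = 0 \<longrightarrow>
       p = 0 \<and> q = 0 \<and> r = 0 \<and> s = 0)" (is "?L \<longleftrightarrow> ?R")
proof
  assume L: ?L
  show ?R
  proof (intro allI impI)
    fix p q r s :: real
    assume h: "p + q + r + s = 0 \<and> p *\<^sub>R a + q *\<^sub>R b + r *\<^sub>R c + s *\<^sub>R d = 0"
    define U where "U = (\<lambda>v. if v = a then p else if v = b then q else if v = c then r else s)"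
    have "sum U {a, b, c, d} = 0" "(\<Sum>v\<in>{a, b, c, d}. U v *\<^sub>R v) = 0"
      using h assms by (auto simp: U_def algebra_simps)
    then have "\<forall>v\<in>{a, b, c, d}. U v = 0"
      using L by (auto simp: affine_dependent_explicit_finite)
    then show "p = 0 \<and> q = 0 \<and> r = 0 \<and> s = 0"
      using assms by (auto simp: U_def split: if_splits)
  qed
next
  assume R: ?R
  show ?L
  proof
    assume "affine_dependent {a, b, c, d}"
    then obtain U where U: "sum U {a, b, c, d} = 0" "(\<Sum>v\<in>{a, b, c, d}. U v *\<^sub>R v) = 0"
      "\<exists>v\<in>{a, b, c, d}. U v \<noteq> 0"
      by (auto simp: affine_dependent_explicit_finite)
    have "U a + U b + U c + U d = 0" "U a *\<^sub>R a + U b *\<^sub>R b + U c *\<^sub>R c + U d *\<^sub>R d = 0"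
      using U(1,2) assms by (simp_all add: algebra_simps)
    then have "U a = 0 \<and> U b = 0 \<and> U c = 0 \<and> U d = 0"
      using R by blast
    with U(3) show False by auto
  qed
qed

lemma midpoint_neq:
  fixes a b :: point
  assumes "a \<noteq> b"
  shows "midpoint a b \<noteq> a" "midpoint a b \<noteq> b" "a \<noteq> midpoint a b" "b \<noteq> midpoint a b"
  using assms midpoint_eq_endpoint[of a b] by metis+

lemma midpoint_notin_affine_independent:
  fixes A :: "point set"
  assumes "\<not> affine_dependent A" "a \<in> A" "b \<in> A" "a \<noteq> b"
  shows "midpoint a b \<notin> A"
proof
  assume m: "midpoint a b \<in> A"
  have "midpoint a b \<in> affine hull {a, b}"
    by (metis convex_hull_subset_affine_hull midpoint_in_closed_segment segment_convex_hull subsetD)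
  moreover have "{a, b} \<subseteq> A - {midpoint a b}"
    using assms midpoint_neq[of a b] by auto
  ultimately have "midpoint a b \<in> affine hull (A - {midpoint a b})"
    using hull_mono by blast
  with m assms(1) show False by (auto simp: affine_dependent_def)
qed

lemma affine_independent_bisect:
  fixes a b c d :: point
  assumes "distinct [a, b, c, d]" "\<not> affine_dependent {a, b, c, d}"
  shows "distinct [a, midpoint a b, c, d]" "\<not> affine_dependent {a, midpoint a b, c, d}"
proof -
  have "midpoint a b \<notin> {a, b, c, d}"
    using assms by (intro midpoint_notin_affine_independent) auto
  then show d: "distinct [a, midpoint a b, c, d]"
    using assms(1) midpoint_neq[of a b] by auto
  show "\<not> affine_dependent {a, midpoint a b, c, d}"
    unfolding affine_independent_four[OF d]
  proof (intro allI impI)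
    fix p q r s :: real
    assume h: "p + q + r + s = 0 \<and>
      p *\<^sub>R a + q *\<^sub>R midpoint a b + r *\<^sub>R c + s *\<^sub>R d = 0"
    \<comment> \<open>A dependency among the vertices of the child becomes one among those of the
      parent: the weight \<open>q\<close> of the midpoint is shared equally between \<open>a\<close>
      and \<open>b\<close>.\<close>
    have "(p + q/2) + q/2 + r + s = 0" using h by simp
    moreover have "(p + q/2) *\<^sub>R a + (q/2) *\<^sub>R b + r *\<^sub>R c + s *\<^sub>R d = 0"
      using h by (simp add: midpoint_def algebra_simps)
    ultimately have "p + q/2 = 0 \<and> q/2 = 0 \<and> r = 0 \<and> s = 0"
      using assms(2) unfolding affine_independent_four[OF assms(1)] by blast
    then show "p = 0 \<and> q = 0 \<and> r = 0 \<and> s = 0" by simp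
  qed
qed

lemma not_coplanar_affine_independent:
  fixes S :: "point set"
  assumes "\<not> affine_dependent S" "card S = 4"
  shows "\<not> coplanar S"
proof
  assume "coplanar S"
  then obtain u v w where "S \<subseteq> affine hull {u, v, w}" by (auto simp: coplanar_def)
  then have "aff_dim S \<le> aff_dim {u, v, w}"
    by (metis aff_dim_affine_hull aff_dim_subset)
  also have "\<dots> \<le> 2"
    using aff_dim_le_card[of "{u, v, w}"] card_insert_le_m1[of 3 "{v, w}" u] card_insert_le_m1[of 2 "{w}" v]
    by (simp add: card_insert_if split: if_splits)
  finally show False
    using aff_dim_affine_independent[OF assms(1)] assms(2) by simp
qed

lemma coplanar_subset_triangle: "S \<subseteq> {a, b, c} \<Longrightarrow> coplanar (S :: point set)"
  unfolding coplanar_def by (meson hull_subset order_trans)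


text \<open>A normal form with the refinement edge named first. Only the marks of the two
  nonrefinement faces stay free; the flag is tracked separately. Relabelling by
  \<open>tet_data_swap\<close> lets statements about the child at \<open>a\<close> serve for the
  child at \<open>b\<close> as well.\<close>

definition tet_data ::
  "marked_tet \<Rightarrow> point \<Rightarrow> point \<Rightarrow> point \<Rightarrow> point \<Rightarrow> point set \<Rightarrow> point set \<Rightarrow> bool" where
  "tet_data K a b c d p q \<longleftrightarrow>
     verts K = {a, b, c, d} \<and> distinct [a, b, c, d] \<and> \<not> affine_dependent {a, b, c, d} \<and>
     refedge K = {a, b} \<and> mark K {a, b, c} = {a, b} \<and> mark K {a, b, d} = {a, b} \<and>
     mark K {a, c, d} = p \<and> mark K {b, c, d} = q"

lemma faces_four:
  assumes "distinct [a, b, c, d]"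
  shows "faces {a, b, c, d} = {{a, b, c}, {a, b, d}, {a, c, d}, {b, c, d}}"
proof -
  let ?A = "{a, b, c, d}"
  have "F \<in> {{a, b, c}, {a, b, d}, {a, c, d}, {b, c, d}}" if F: "F \<subseteq> ?A" "card F = 3" for F
  proof -
    have "card (?A - F) = 1"
      using F assms by (simp add: card_Diff_subset finite_subset)
    then obtain x where x: "?A - F = {x}" by (auto simp: card_1_singleton_iff)
    then have "F = ?A - {x}" "x \<in> ?A" using F(1) by blast+
    moreover have "?A - {a} = {b, c, d}" "?A - {b} = {a, c, d}" "?A - {c} = {a, b, d}"
      "?A - {d} = {a, b, c}" using assms by auto
    ultimately show ?thesis by auto
  qed
  then have "faces ?A \<subseteq> {{a, b, c}, {a, b, d}, {a, c, d}, {b, c, d}}"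
    unfolding faces_def by blast
  moreover have "{{a, b, c}, {a, b, d}, {a, c, d}, {b, c, d}} \<subseteq> faces ?A"
    using assms by (simp add: faces_def)
  ultimately show ?thesis by (rule equalityI)
qed

lemma edges_three:
  assumes "distinct [a, b, c]"
  shows "edges {a, b, c} = {{a, b}, {a, c}, {b, c}}"
proof -
  let ?A = "{a, b, c}"
  have "F \<in> {{a, b}, {a, c}, {b, c}}" if F: "F \<subseteq> ?A" "card F = 2" for F
  proof -
    have "card (?A - F) = 1"
      using F assms by (simp add: card_Diff_subset finite_subset)
    then obtain x where x: "?A - F = {x}" by (auto simp: card_1_singleton_iff)
    then have "F = ?A - {x}" "x \<in> ?A" using F(1) by blast+
    moreover have "?A - {a} = {b, c}" "?A - {b} = {a, c}" "?A - {c} = {a, b}"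
      using assms by auto
    ultimately show ?thesis by auto
  qed
  then have "edges ?A \<subseteq> {{a, b}, {a, c}, {b, c}}"
    unfolding edges_def by blast
  moreover have "{{a, b}, {a, c}, {b, c}} \<subseteq> edges ?A"
    using assms by (simp add: edges_def)
  ultimately show ?thesis by (rule equalityI)
qed

lemma tet_data_swap:
  "tet_data K a b c d p q \<Longrightarrow> tet_data K b a c d q p"
  "tet_data K a b c d p q \<Longrightarrow> tet_data K a b d c p q"
  by (auto simp: tet_data_def insert_commute)

lemma marked_tetrahedron_imp_data:
  assumes K: "marked_tetrahedron K" and r: "refedge K = {a, b}" "a \<noteq> b" 
    and V: "verts K = {a, b, c, d}"
  shows "tet_data K a b c d (mark K {a, c, d}) (mark K {b, c, d})"
    and "mark K {a, c, d} \<in> {{a, c}, {a, d}, {c, d}}"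
proof -
  have dist: "distinct [a, b, c, d]"
    using K V by (auto simp: marked_tetrahedron_def card_insert_if split: if_splits)
  show "tet_data K a b c d (mark K {a, c, d}) (mark K {b, c, d})"
    using K r V dist by (simp add: marked_tetrahedron_def tet_data_def faces_four)
  have "mark K {a, c, d} \<in> edges {a, c, d}"
    using K V dist by (simp add: marked_tetrahedron_def faces_four)
  then show "mark K {a, c, d} \<in> {{a, c}, {a, d}, {c, d}}"
    using dist by (simp add: edges_three)
qed

lemma data_imp_marked_tetrahedron:
  assumes "tet_data K a b c d p q" "p \<in> {{a, c}, {a, d}, {c, d}}" "q \<in> {{b, c}, {b, d}, {c, d}}"
    "\<not> flag K"
  shows "marked_tetrahedron K"
proof -
  have dist: "distinct [a, b, c, d]" and V: "verts K = {a, b, c, d}"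
    using assms by (simp_all add: tet_data_def)
  have "{a, b} \<in> edges {a, b, c, d}" using dist by (auto simp: edges_def)
  moreover have "\<forall>F\<in>faces (verts K). mark K F \<in> edges F \<and> (refedge K \<subseteq> F \<longrightarrow> mark K F = refedge K)"
    using assms dist by (auto simp: V faces_four tet_data_def edges_three)
  ultimately show ?thesis
    using assms dist by (auto simp: marked_tetrahedron_def tet_data_def)
qed

lemma coplanar_marks_data:
  assumes "tet_data K a b c d p q"
  shows "coplanar_marks K \<longleftrightarrow> coplanar ({a, b} \<union> p \<union> q)"
proof -
  have dist: "distinct [a, b, c, d]" and V: "verts K = {a, b, c, d}"
    using assms by (simp_all add: tet_data_def)
  have "(\<Union>F\<in>faces (verts K). mark K F) = {a, b} \<union> p \<union> q"
    unfolding V faces_four[OF dist] using assms by (auto simp: tet_data_def)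
  then show ?thesis by (simp add: coplanar_marks_def)
qed

lemma coplanar_marks_common_endpoint:
  assumes "tet_data K a b c d {a, c} {b, c}"
  shows "coplanar_marks K"
  unfolding coplanar_marks_data[OF assms] by (rule coplanar_subset_triangle[of _ a b c]) auto

lemma not_coplanar_marks_data:
  assumes "tet_data K a b c d p q" "{a, b, c, d} \<subseteq> {a, b} \<union> p \<union> q"
  shows "\<not> coplanar_marks K"
proof -
  have "\<not> coplanar {a, b, c, d}"
    using assms(1) by (intro not_coplanar_affine_independent) (auto simp: tet_data_def)
  then show ?thesis
    unfolding coplanar_marks_data[OF assms(1)] using assms(2) coplanar_subset by blast
qed

lemma new_face_mark_unflagged:
  assumes "tet_data K a b c d p q" "\<not> type_Pf K"
  shows "new_face_mark K = {c, d}"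
  using assms by (auto simp: tet_data_def new_face_mark_def)

lemma new_face_mark_flagged:
  assumes "tet_data K a b c d {a, c} {b, c}" "flag K"
  shows "new_face_mark K = {midpoint a b, c}"
proof -
  have [simp]: "verts K - refedge K = {c, d}" "inherited_face K a = {a, c, d}"
    "inherited_face K b = {b, c, d}" "refedge K = {a, b}" and ab: "a \<noteq> b" 
    "distinct [a, b, c, d]"
    using assms by (auto simp: tet_data_def inherited_face_def)
  have "common_old_endpoint K = c"
    unfolding common_old_endpoint_def
    using assms by (intro the_equality) (auto simp: tet_data_def)
  then show ?thesis
    using assms coplanar_marks_common_endpoint[OF assms(1)] ab
    by (simp add: new_face_mark_def type_Pf_def new_vertex_def mid_pair)
qed

lemma child_data:
  assumes "tet_data K a b c d p q"
  defines "m \<equiv> midpoint a b"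
  shows "verts (child K a) = {a, m, c, d}" "refedge (child K a) = p"
    "mark (child K a) {a, c, d} = p" "mark (child K a) {m, c, d} = new_face_mark K"
    "mark (child K a) {a, m, c} = {a, c}" "mark (child K a) {a, m, d} = {a, d}"
    "flag (child K a) = type_Pu K"
    "distinct [a, m, c, d]" "\<not> affine_dependent {a, m, c, d}" "m \<noteq> b"
proof -
  have dist: "distinct [a, b, c, d]" and ind: "\<not> affine_dependent {a, b, c, d}"
    using assms by (simp_all add: tet_data_def)
  have *: "verts K - refedge K = {c, d}" "inherited_face K a = {a, c, d}"
    "refedge K = {a, b}" "new_vertex K = m" "new_face K = {m, c, d}"
    using assms dist by (auto simp: tet_data_def inherited_face_def new_vertex_def mid_pair new_face_def)
  show D: "distinct [a, m, c, d]" "\<not> affine_dependent {a, m, c, d}"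
    unfolding m_def using affine_independent_bisect[OF dist ind] by auto
  show "m \<noteq> b"
    unfolding m_def using dist by simp
  have "{m, c, d} \<noteq> {a, c, d}" "{a, m, c} \<noteq> {a, c, d}" "{a, m, d} \<noteq> {a, c, d}"
    "{a, m, c} \<noteq> {m, c, d}" "{a, m, d} \<noteq> {m, c, d}" using D(1) by auto
  then show "verts (child K a) = {a, m, c, d}" "refedge (child K a) = p"
    "mark (child K a) {a, c, d} = p" "mark (child K a) {m, c, d} = new_face_mark K"
    "mark (child K a) {a, m, c} = {a, c}" "mark (child K a) {a, m, d} = {a, d}"
    "flag (child K a) = type_Pu K"
    using assms D(1) by (auto simp: child_def * tet_data_def)
qed

text \<open>The nonrefinement faces of the child are one cut face and the new face, so the flag of
  \<open>K\<close> can influence the child here, through \<open>new_face_mark K\<close>.\<close>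

lemma child_data_meeting:
  assumes "tet_data K a b c d {a, c} q"
  shows "tet_data (child K a) a c d (midpoint a b) {a, d} (new_face_mark K)"
  using child_data[OF assms] by (simp add: tet_data_def insert_commute) (auto simp: insert_commute)

text \<open>The new face contains the refinement edge \<open>{c, d}\<close> of the child and has to
  be marked by it, which the unflagged rule does. Both nonrefinement faces of the child are cut
  faces.\<close>

lemma child_data_unmeeting:
  assumes "tet_data K a b c d {c, d} q" "\<not> type_Pf K"
  shows "tet_data (child K a) c d a (midpoint a b) {c, a} {d, a}"
  using child_data[OF assms(1)] new_face_mark_unflagged[OF assms]
  by (simp add: tet_data_def insert_commute) (auto simp: insert_commute)


section \<open>Three successive bisections\<close>

lemma nonref_faces_data:
  assumes "tet_data K a b c d p q"
  shows "nonref_faces K = {{a, c, d}, {b, c, d}}"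
proof -
  have dist: "distinct [a, b, c, d]" and V: "verts K = {a, b, c, d}" "refedge K = {a, b}"
    using assms by (simp_all add: tet_data_def)
  show ?thesis
    unfolding nonref_faces_def V faces_four[OF dist] using dist by auto
qed

lemma type_A_data:
  assumes "tet_data K a b c d p q"
  shows "type_A K \<longleftrightarrow> p \<inter> {a, b} \<noteq> {} \<and> q \<inter> {a, b} \<noteq> {} \<and> \<not> coplanar_marks K"
  using assms unfolding type_A_def nonref_faces_data[OF assms] by (simp add: tet_data_def)

text \<open>
  The child of \<open>K\<close> at \<open>v\<close> has refinement edge \<open>{x, y}\<close>, and its child at \<open>x\<close> has refinement edge
  \<open>{x, z}\<close>. Since \<open>x\<close> and \<open>y\<close> may be exchanged, following \<open>x\<close> is no restriction.
\<close>

locale thrice =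
  fixes K u v x y z
  assumes K: "marked_tetrahedron K" and unflagged: "\<not> flag K"
    and verts: "verts K = {u, x, y, z}" and v: "v \<in> {x, y, z}"
    and refedge: "refedge K = {v, u}" and mark_xyz: "mark K {x, y, z} = {x, y}"
begin

abbreviation "m1 \<equiv> midpoint v u"
abbreviation "m2 \<equiv> midpoint x y"
abbreviation "m3 \<equiv> midpoint x z"
abbreviation "K1 \<equiv> child K v"
abbreviation "K2 \<equiv> child K1 x"

lemma dist: "distinct [u, x, y, z]"
  using K verts by (auto simp: marked_tetrahedron_def card_insert_if split: if_splits)

lemma v_neq_u: "v \<noteq> u"
  using dist v by auto

lemma not_type_Pf: "\<not> type_Pf K"
  using unflagged by (simp add: type_Pf_def)

text \<open>All three faces of \<open>K1\<close> through \<open>m1\<close> are marked by their edge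
  opposite \<open>m1\<close>: the cut faces always, the new face because \<open>K\<close> is not of
  type \<open>type_Pf\<close>. So the position of \<open>v\<close> among \<open>x\<close>,
  \<open>y\<close>, \<open>z\<close> leaves no trace in the marks of \<open>K1\<close>. They all lie
  in the triangle \<open>{x, y, z}\<close>, hence \<open>K1\<close> always has coplanar
  marks.\<close>

lemma data1: "tet_data K1 x y z m1 {x, z} {y, z}"
proof -
  have d: "tet_data K v u c d (mark K {v, c, d}) (mark K {u, c, d})" if "verts K = {v, u, c, d}" for c d
    using marked_tetrahedron_imp_data(1)[OF K refedge v_neq_u that] .
  have "v = x \<or> v = y \<or> v = z" using v by simp
  then show ?thesis
  proof (elim disjE)
    assume [simp]: "v = x"
    have "tet_data K x u y z {x, y} (mark K {u, y, z})"
      using d[of y z] verts mark_xyz by (simp add: insert_commute)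
    from child_data_meeting[OF this] new_face_mark_unflagged[OF this not_type_Pf]
    show ?thesis by simp
  next
    assume [simp]: "v = y"
    have "tet_data K y u x z {y, x} (mark K {u, x, z})"
      using d[of x z] verts mark_xyz by (simp add: insert_commute)
    from child_data_meeting[OF this] new_face_mark_unflagged[OF this not_type_Pf]
    show ?thesis by (simp add: tet_data_swap(1))
  next
    assume [simp]: "v = z"
    have "tet_data K z u x y {x, y} (mark K {u, x, y})"
      using d[of x y] verts mark_xyz by (simp add: insert_commute)
    from child_data_unmeeting[OF this not_type_Pf]
    show ?thesis by simp
  qed
qed

lemma flag1: "flag K1 \<longleftrightarrow> type_Pu K"
  by (simp add: child_def)

text \<open>Here the type of \<open>K\<close> first shows in a mark: \<open>K1\<close> has coplanar
  marks in any case, so it has type \<open>type_Pf\<close> iff it is flagged, and \<open>z\<close>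
  is the common endpoint of \<open>{x, z}\<close> and \<open>{y, z}\<close>.\<close>

lemma new_face_mark1: "new_face_mark K1 = (if type_Pu K then {m2, z} else {z, m1})"
  using new_face_mark_flagged[OF data1] new_face_mark_unflagged[OF data1] flag1
  by (auto simp: type_Pf_def)

lemma data2: "tet_data K2 x z m1 m2 {x, m1} (if type_Pu K then {m2, z} else {z, m1})"
  using child_data_meeting[OF data1] unfolding new_face_mark1 .

lemma flag2: "flag K2 \<longleftrightarrow> \<not> type_Pu K"
  using coplanar_marks_common_endpoint[OF data1] flag1 by (simp add: child_def type_Pu_def)

text \<open>The roles are now reversed: \<open>K2\<close> has type \<open>type_Pf\<close> iff
  \<open>K\<close> is not of type \<open>type_Pu\<close>, and then \<open>m1\<close> is the common
  endpoint.\<close>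

lemma new_face_mark2: "new_face_mark K2 = (if type_Pu K then {m1, m2} else {m1, m3})"
proof (cases "type_Pu K")
  case True
  then show ?thesis
    using new_face_mark_unflagged[OF data2] flag2 by (simp add: type_Pf_def)
next
  case False
  then have "tet_data K2 x z m1 m2 {x, m1} {z, m1}" using data2 by simp
  from new_face_mark_flagged[OF this] show ?thesis
    using False flag2 by (simp add: insert_commute)
qed

lemma data3x:
  "tet_data (child K2 x) x m1 m2 m3 {x, m2} (if type_Pu K then {m1, m2} else {m1, m3})"
  using child_data_meeting[OF data2] unfolding new_face_mark2 .

text \<open>Unlike at \<open>x\<close>, the refinement edge at \<open>z\<close> depends on the type
  of \<open>K\<close>, because the inherited face \<open>{z, m1, m2}\<close> is the new face of
  \<open>K1\<close>.\<close>

lemma data3z: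
  "type_Pu K \<Longrightarrow> tet_data (child K2 z) z m2 m1 m3 {z, m1} {m1, m2}"
  "\<not> type_Pu K \<Longrightarrow> tet_data (child K2 z) z m1 m2 m3 {z, m2} {m1, m3}"
proof -
  assume P: "type_Pu K"
  have "tet_data K2 z x m2 m1 {z, m2} {x, m1}"
    using tet_data_swap(2)[OF tet_data_swap(1)[OF data2]] P by (simp add: insert_commute)
  from child_data_meeting[OF this] new_face_mark2 P
  show "tet_data (child K2 z) z m2 m1 m3 {z, m1} {m1, m2}" by (simp add: midpoint_sym)
next
  assume P: "\<not> type_Pu K"
  have "tet_data K2 z x m1 m2 {z, m1} {x, m1}"
    using tet_data_swap(1)[OF data2] P by (simp add: insert_commute)
  from child_data_meeting[OF this] new_face_mark2 P
  show "tet_data (child K2 z) z m1 m2 m3 {z, m2} {m1, m3}" by (simp add: midpoint_sym)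
qed

lemma verts1: "verts K1 = {x, y, z, m1}"
  using data1 by (simp add: tet_data_def)

lemma verts2: "verts K2 = {x, z, m1, m2}"
  using data2 by (simp add: tet_data_def)

lemma verts3: "w \<in> {x, z} \<Longrightarrow> verts (child K2 w) = {w, m1, m2, m3}"
  using data3x data3z by (cases "type_Pu K") (auto simp: tet_data_def)

lemma refedge1: "refedge K1 = {x, y}"
  using data1 by (simp add: tet_data_def)

lemma refedge2: "refedge K2 = {x, z}"
  using data2 by (simp add: tet_data_def)

lemma midpoint_notin_verts: "a \<in> verts K \<Longrightarrow> b \<in> verts K \<Longrightarrow> a \<noteq> b \<Longrightarrow> midpoint a b \<notin> verts K"
  using K by (intro midpoint_notin_affine_independent) (auto simp: marked_tetrahedron_def)

lemma dist_all: "distinct [u, x, y, z, m1, m2, m3]"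
proof -
  have "m1 \<notin> {u, x, y, z}" "m2 \<notin> {u, x, y, z}" "m3 \<notin> {u, x, y, z}"
    using midpoint_notin_verts verts v dist by auto
  then have "set [u, x, y, z] \<inter> set [m1, m2, m3] = {}" by simp
  moreover have "distinct [m1, m2, m3]" using data3x by (simp add: tet_data_def)
  ultimately have "distinct ([u, x, y, z] @ [m1, m2, m3])"
    unfolding distinct_append using dist by blast
  then show ?thesis by (simp only: append.simps)
qed

text \<open>\<open>K2\<close> is never of type \<open>type_Pu\<close>. If \<open>K\<close> is, the
  marks of \<open>K2\<close> contain all four vertices and are not coplanar; if \<open>K\<close> is
  not, then \<open>K2\<close> itself carries the flag.\<close>

lemma unflagged3: "\<not> flag (child K2 w)"
proof (cases "type_Pu K")
  case True
  have "\<not> coplanar_marks K2"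
    by (rule not_coplanar_marks_data[OF data2]) (use True in auto)
  then show ?thesis by (simp add: child_def type_Pu_def)
next
  case False
  then show ?thesis using flag2 by (simp add: child_def type_Pu_def)
qed

lemma marked_tetrahedron3:
  assumes "w \<in> {x, z}"
  shows "marked_tetrahedron (child K2 w)"
proof (cases "w = x")
  case True
  then show ?thesis
    using data_imp_marked_tetrahedron[OF data3x _ _ unflagged3] by (simp split: if_splits)
next
  case False
  then have [simp]: "w = z" using assms by simp
  show ?thesis
  proof (cases "type_Pu K")
    case True
    show ?thesis
      using data_imp_marked_tetrahedron[OF data3z(1)[OF True] _ _ unflagged3]
      by (simp add: insert_commute)
  next
    case False
    show ?thesis
      using data_imp_marked_tetrahedron[OF data3z(2)[OF False] _ _ unflagged3] by simp
  qed
qed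

text \<open>If \<open>K\<close> is of type \<open>type_Pu\<close>, the marks of a descendant form a
  triangle. Otherwise both nonrefinement marks meet the refinement edge, and all marks together
  contain the four vertices. In particular the types O and M do not survive three
  bisections.\<close>

lemma type3:
  assumes "w \<in> {x, z}"
  shows "type_Pu K \<Longrightarrow> type_Pu (child K2 w)" "\<not> type_Pu K \<Longrightarrow> type_A (child K2 w)"
proof -
  assume P: "type_Pu K"
  have "tet_data (child K2 x) m1 x m2 m3 {m1, m2} {x, m2}"
    using tet_data_swap(1)[OF data3x] P by simp
  moreover have "tet_data (child K2 z) m2 z m1 m3 {m2, m1} {z, m1}"
    using tet_data_swap(1)[OF data3z(1)[OF P]] by (simp add: insert_commute)
  ultimately show "type_Pu (child K2 w)"
    using coplanar_marks_common_endpoint unflagged3 assms by (auto simp: type_Pu_def)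
next
  assume P: "\<not> type_Pu K"
  have 1: "tet_data (child K2 x) x m1 m2 m3 {x, m2} {m1, m3}"
    using data3x P by simp
  have "type_A (child K2 x)"
    unfolding type_A_data[OF 1] using not_coplanar_marks_data[OF 1] by auto
  moreover have "type_A (child K2 z)"
    unfolding type_A_data[OF data3z(2)[OF P]]
    using not_coplanar_marks_data[OF data3z(2)[OF P]] by auto
  ultimately show "type_A (child K2 w)" using assms by auto
qed

end

lemma child_in_bisect_all: "K \<in> T \<Longrightarrow> v \<in> refedge K \<Longrightarrow> child K v \<in> bisect_all T"
  by (auto simp: bisect_all_def children_def)

lemma thrice_imp_bisect_all:
  assumes "thrice K u v x y z" "w \<in> {x, z}" "K \<in> T"
  shows "child (child (child K v) x) w \<in> bisect_all (bisect_all (bisect_all T))"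
  using assms thrice.refedge[OF assms(1)] thrice.refedge1[OF assms(1)] thrice.refedge2[OF assms(1)]
  by (intro child_in_bisect_all) auto

lemma thrice_swap: "thrice K u v x y z \<Longrightarrow> thrice K u v y x z"
  by (auto simp: thrice_def insert_commute)

lemma thrice_exists:
  assumes K: "marked_tetrahedron K" "\<not> flag K" and v: "v \<in> refedge K"
  obtains u x y z where "thrice K u v x y z"
proof -
  have e: "card (refedge K) = 2" "refedge K \<subseteq> verts K" "card (verts K) = 4"
    using K(1) by (auto simp: marked_tetrahedron_def edges_def)
  then obtain u where u: "refedge K = {v, u}" "v \<noteq> u"
    using v by (auto simp: card_2_iff doubleton_eq_iff)
  have "finite (verts K)" using e(3) by (simp add: card_ge_0_finite)
  then have c3: "card (verts K - {u}) = 3" using e u by simp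
  then obtain c d e where cde: "verts K - {u} = {c, d, e}" "distinct [c, d, e]"
    by (auto simp: card_3_iff)
  have "verts K - {u} \<in> faces (verts K)" using c3 by (auto simp: faces_def)
  then have "mark K {c, d, e} \<in> edges {c, d, e}"
    using K(1) cde by (auto simp: marked_tetrahedron_def)
  then have mk: "mark K {c, d, e} \<in> {{c, d}, {c, e}, {d, e}}"
    using edges_three[OF cde(2)] by simp
  have "verts K = {u, c, d, e}" "v \<in> {c, d, e}"
    using cde u \<open>refedge K \<subseteq> verts K\<close> by blast+
  \<comment> \<open>The mark of the face opposite \<open>u\<close> decides which of its vertices
    plays the role of \<open>z\<close>.\<close>
  then have "thrice K u v c d e \<or> thrice K u v c e d \<or> thrice K u v d e c"
    using mk K u by (auto simp: thrice_def insert_commute)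
  then show thesis using that by blast
qed

lemma thrice_bisected_cases:
  assumes K: "marked_tetrahedron K" "\<not> flag K"
    and J: "J \<in> children K" "L \<in> children J" "M \<in> children L"
  obtains u v x y z w where "thrice K u v x y z" "w \<in> {x, z}" "M = child (child (child K v) x) w"
proof -
  obtain v where vJ: "v \<in> refedge K" "J = child K v"
    using J(1) by (auto simp: children_def)
  obtain u x y z where th: "thrice K u v x y z" using thrice_exists[OF K vJ(1)] .
  note th' = thrice_swap[OF th]
  interpret thrice K u v x y z by fact
  have "L = child J x \<or> L = child J y"
    using J(2) refedge1 vJ(2) by (auto simp: children_def)
  then show thesis
  proof
    assume "L = child J x"
    then show thesis using that[OF th] J(3) refedge2 vJ(2) by (auto simp: children_def)
  next
    assume "L = child J y"
    then show thesis
      using that[OF th'] J(3) thrice.refedge2[OF th'] vJ(2) by (auto simp: children_def)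
  qed
qed

lemma thrice_bisect_all_cases:
  assumes "M \<in> bisect_all (bisect_all (bisect_all T))"
    "\<And>K. K \<in> T \<Longrightarrow> marked_tetrahedron K \<and> \<not> flag K"
  obtains K u v x y z w where "K \<in> T" "thrice K u v x y z" "w \<in> {x, z}"
    "M = child (child (child K v) x) w"
  using assms thrice_bisected_cases unfolding bisect_all_def by (smt (verit) UN_E)


section \<open>Barycentric coordinates under bisection\<close>

text \<open>Barycentric coordinates are total functions that vanish off \<open>A\<close>.
  Coordinates in different tetrahedra can then be compared by equality, and equality confines the
  support to the common vertices.\<close>

definition coords :: "point set \<Rightarrow> (point \<Rightarrow> real) \<Rightarrow> bool" where
  "coords A f \<longleftrightarrow> (\<forall>v. 0 \<le> f v) \<and> (\<forall>v. v \<notin> A \<longrightarrow> f v = 0) \<and> sum f A = 1"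

definition comb :: "point set \<Rightarrow> (point \<Rightarrow> real) \<Rightarrow> point" where
  "comb A f = (\<Sum>v\<in>A. f v *\<^sub>R v)"

text \<open>
  If \<open>f\<close> are the barycentric coordinates of a point in a tetrahedron with refinement edge \<open>{a, b}\<close>,
  then \<open>split_edge a b f\<close> are its coordinates in the child that contains the point.
\<close>

definition split_edge :: "point \<Rightarrow> point \<Rightarrow> (point \<Rightarrow> real) \<Rightarrow> point \<Rightarrow> real" where
  "split_edge a b f = (\<lambda>v.
     if v = midpoint a b then f v + 2 * min (f a) (f b)
     else if v = a \<or> v = b then f v - min (f a) (f b)
     else f v)"

lemma split_edge_commute: "split_edge a b f = split_edge b a f"
  by (auto simp: split_edge_def midpoint_sym min.commute fun_eq_iff)

lemma split_edge_id: "(\<forall>v. 0 \<le> f v) \<Longrightarrow> f a = 0 \<or> f b = 0 \<Longrightarrow> split_edge a b f = f"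
  by (auto simp: split_edge_def fun_eq_iff)

lemma split_edge_nonneg: "\<forall>v. 0 \<le> f v \<Longrightarrow> \<forall>v. 0 \<le> split_edge a b f v"
  by (auto simp: split_edge_def)

lemma split_edge_other: "c \<noteq> midpoint a b \<Longrightarrow> c \<noteq> a \<Longrightarrow> c \<noteq> b \<Longrightarrow> split_edge a b f c = f c"
  by (simp add: split_edge_def)

lemma split_edge_le: "(\<forall>v. 0 \<le> f v) \<Longrightarrow> c \<noteq> midpoint a b \<Longrightarrow> split_edge a b f c \<le> f c"
  by (simp add: split_edge_def)

lemma split_edge_zero:
  "(\<forall>v. 0 \<le> f v) \<Longrightarrow> f c = 0 \<Longrightarrow> c \<noteq> midpoint a b \<Longrightarrow> split_edge a b f c = 0"
  by (auto simp: split_edge_def min_def order_antisym)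

lemma split_edge_midpoint_pos:
  "f (midpoint a b) = 0 \<Longrightarrow> 0 < split_edge a b f (midpoint a b) \<Longrightarrow> 0 < f a \<and> 0 < f b"
  by (auto simp: split_edge_def)

lemma split_edge_endpoint_zero:
  "a \<noteq> b \<Longrightarrow> split_edge a b f a = 0 \<or> split_edge a b f b = 0"
  using midpoint_neq[of a b] by (auto simp: split_edge_def min_def)

text \<open>This is the subdivision of a triangle with marked edge \<open>{a, b}\<close> into four.
  After the first cut the weight at \<open>a\<close> or at \<open>b\<close> is zero, so only one of
  the two later cuts can act on a given point.\<close>

definition face_split :: "point \<Rightarrow> point \<Rightarrow> point \<Rightarrow> (point \<Rightarrow> real) \<Rightarrow> point \<Rightarrow> real" where
  "face_split a b c f = split_edge a c (split_edge b c (split_edge a b f))"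

lemma face_split_zero:
  assumes "\<forall>v. 0 \<le> f v"
  shows "f a = 0 \<Longrightarrow> a \<noteq> midpoint b c \<Longrightarrow> face_split a b c f = split_edge b c f"
    "f b = 0 \<Longrightarrow> face_split a b c f = split_edge a c f"
    "f c = 0 \<Longrightarrow> c \<noteq> midpoint a b \<Longrightarrow> face_split a b c f = split_edge a b f"
  using assms
  by (simp_all add: face_split_def split_edge_id split_edge_zero split_edge_nonneg)

lemma coords_child:
  assumes K: "tet_data K a b c d p q" and g: "coords (verts (child K a)) g"
  obtains f where "coords (verts K) f" "comb (verts K) f = comb (verts (child K a)) g"
    "g = split_edge a b f"
proof -
  let ?m = "midpoint a b"
  have V: "verts (child K a) = {a, ?m, c, d}" "verts K = {a, b, c, d}"
    using child_data[OF K] K by (auto simp: tet_data_def)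
  have dist: "distinct [a, ?m, c, d]" "?m \<noteq> b" "distinct [a, b, c, d]"
    using child_data[OF K] K by (auto simp: tet_data_def)
  \<comment> \<open>Each endpoint receives half of the weight of the midpoint. The smaller of the
    two resulting weights is the one at \<open>b\<close>, exactly that half, so
    \<open>split_edge\<close> gives \<open>g\<close> back.\<close>
  define f where "f = (\<lambda>v. if v = ?m then 0 else if v = a then g a + g ?m / 2
    else if v = b then g ?m / 2 else g v)"
  have g': "\<forall>v. 0 \<le> g v" "\<And>v. v \<notin> {a, ?m, c, d} \<Longrightarrow> g v = 0" "g a + g ?m + g c + g d = 1"
    using g dist by (simp_all add: coords_def V algebra_simps)
  have "b \<noteq> ?m" using dist(3) by (intro midpoint_neq) auto
  then have gb: "g b = 0" using dist(3) by (intro g'(2)) auto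
  have fs: "f a = g a + g ?m / 2" "f b = g ?m / 2" "f c = g c" "f d = g d" "f ?m = 0"
    using dist \<open>b \<noteq> ?m\<close> by (auto simp: f_def)
  have "coords (verts K) f"
    using g' fs gb dist unfolding coords_def V by (auto simp: f_def)
  moreover have "comb (verts K) f = comb (verts (child K a)) g"
    using dist unfolding comb_def V by (simp add: fs) (simp add: midpoint_def algebra_simps)
  moreover have "g = split_edge a b f"
  proof
    fix v
    show "g v = split_edge a b f v"
      using dist gb g'(1)[rule_format, of a] fs by (auto simp: split_edge_def min_def f_def)
  qed
  ultimately show thesis using that by blast
qed

lemma finite_verts: "marked_tetrahedron K \<Longrightarrow> finite (verts K)"
  by (simp add: marked_tetrahedron_def card_ge_0_finite)

lemma coords_unique:
  assumes "\<not> affine_dependent A" "finite A" "coords A f" "coords A g" "comb A f = comb A g"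
  shows "f = g"
proof -
  have "sum (\<lambda>v. f v - g v) A = 0" "(\<Sum>v\<in>A. (f v - g v) *\<^sub>R v) = 0"
    using assms(3-5) by (simp_all add: coords_def comb_def sum_subtractf algebra_simps)
  then have "\<forall>v\<in>A. f v - g v = 0"
    using assms(1,2) unfolding affine_dependent_explicit_finite[OF assms(2)] by blast
  then show ?thesis using assms(3,4) unfolding coords_def fun_eq_iff by (metis diff_eq_diff_eq diff_self)
qed

lemma (in thrice) midpoints_neq:
  "m1 \<notin> {u, x, y, z, m2, m3}" "m2 \<notin> {u, x, y, z, m1, m3}" "m3 \<notin> {u, x, y, z, m1, m2}"
  using dist_all by auto

text \<open>The point itself does not occur. By \<open>coords_descendant\<close> every point of a
  descendant has such a chain of coordinates, and the arguments concern only the values and supports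
  of the four functions.\<close>

locale thrice_coords = thrice +
  fixes w f f1 f2 h
  assumes w: "w \<in> {x, z}"
    and f: "coords (verts K) f" and f1: "coords (verts K1) f1" and f2: "coords (verts K2) f2"
    and h: "coords (verts (child K2 w)) h"
    and f1_eq: "f1 = split_edge v u f" and f2_eq: "f2 = split_edge x y f1"
    and h_eq: "h = split_edge x z f2"
begin

lemma nonneg: "\<forall>v. 0 \<le> f v" "\<forall>v. 0 \<le> f1 v" "\<forall>v. 0 \<le> f2 v" "\<forall>v. 0 \<le> h v"
  using f f1 f2 h by (auto simp: coords_def)

lemma zero_f: "f m1 = 0" "f m2 = 0" "f m3 = 0"
proof -
  have "m1 \<notin> verts K" "m2 \<notin> verts K" "m3 \<notin> verts K"
    using midpoint_notin_verts verts v dist v_neq_u by simp_all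
  then show "f m1 = 0" "f m2 = 0" "f m3 = 0"
    using f by (simp_all add: coords_def)
qed

lemma zero_f1: "f1 u = 0" "f1 m2 = 0" "f1 m3 = 0"
proof -
  have "u \<notin> verts K1" "m2 \<notin> verts K1" "m3 \<notin> verts K1"
    unfolding verts1 using dist_all by auto
  then show "f1 u = 0" "f1 m2 = 0" "f1 m3 = 0"
    using f1 by (simp_all add: coords_def)
qed

lemma zero_f2: "f2 u = 0" "f2 y = 0" "f2 m3 = 0"
proof -
  have "u \<notin> verts K2" "y \<notin> verts K2" "m3 \<notin> verts K2"
    unfolding verts2 using dist_all by auto
  then show "f2 u = 0" "f2 y = 0" "f2 m3 = 0"
    using f2 by (simp_all add: coords_def)
qed

lemma f1_le: "a \<noteq> m1 \<Longrightarrow> f1 a \<le> f a"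
  using split_edge_le[OF nonneg(1), of a v u] by (simp add: f1_eq)

lemma f2_le: "a \<noteq> m2 \<Longrightarrow> f2 a \<le> f1 a"
  using split_edge_le[OF nonneg(2), of a x y] by (simp add: f2_eq)

lemma h_le: "a \<noteq> m3 \<Longrightarrow> h a \<le> f2 a"
  using split_edge_le[OF nonneg(3), of a x z] by (simp add: h_eq)

lemma h_m1: "h m1 = f1 m1"
  using midpoints_neq unfolding h_eq f2_eq by (simp add: split_edge_other)

lemma h_m2: "h m2 = f2 m2"
  using midpoints_neq unfolding h_eq by (simp add: split_edge_other)

text \<open>Positivity is traced backwards: a midpoint carries weight only if both endpoints of its
  edge did before the cut. This later rules out the faces of a descendant that do not lie in a
  prescribed face of an ancestor.\<close>

lemma pos_m1: "0 < h m1 \<Longrightarrow> 0 < f v \<and> 0 < f u"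
  using split_edge_midpoint_pos[of f v u] zero_f h_m1 f1_eq by simp

lemma pos_m2: "0 < h m2 \<Longrightarrow> 0 < f1 x \<and> 0 < f1 y"
  using split_edge_midpoint_pos[of f1 x y] zero_f1 h_m2 f2_eq by simp

lemma pos_m3: "0 < h m3 \<Longrightarrow> 0 < f2 x \<and> 0 < f2 z"
  using split_edge_midpoint_pos[of f2 x z] zero_f2 h_eq by simp

lemma pos_f2: "0 < f2 x \<Longrightarrow> 0 < f1 x" "0 < f2 z \<Longrightarrow> 0 < f1 z"
  using f2_le[of x] f2_le[of z] dist_all by auto

lemma pos_f1: "0 < f1 x \<Longrightarrow> 0 < f x" "0 < f1 y \<Longrightarrow> 0 < f y" "0 < f1 z \<Longrightarrow> 0 < f z"
  using f1_le[of x] f1_le[of y] f1_le[of z] dist_all by auto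

lemma pos_h: "0 < h x \<Longrightarrow> 0 < f2 x" "0 < h z \<Longrightarrow> 0 < f2 z"
  using h_le[of x] h_le[of z] dist_all by auto

lemmas pos = pos_m1 pos_m2 pos_m3 pos_f2 pos_f1 pos_h

end

lemma (in thrice) coords_descendant:
  assumes w: "w \<in> {x, z}" and h: "coords (verts (child K2 w)) h"
  obtains f f1 f2 where "thrice_coords K u v x y z w f f1 f2 h"
    "comb (verts K) f = comb (verts (child K2 w)) h"
proof -
  obtain p q where p: "tet_data K2 w (if w = x then z else x) m1 m2 p q"
  proof (cases "w = x")
    case True
    then show thesis using that data2 by simp
  next
    case False
    then show thesis using that tet_data_swap(1)[OF data2] w by simp
  qed
  obtain f2 where f2: "coords (verts K2) f2" "comb (verts K2) f2 = comb (verts (child K2 w)) h"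
    "h = split_edge w (if w = x then z else x) f2"
    using coords_child[OF p h] .
  have h_eq: "h = split_edge x z f2"
    using f2(3) w split_edge_commute[of z x] by (cases "w = x") simp_all
  obtain f1 where f1: "coords (verts K1) f1" "comb (verts K1) f1 = comb (verts K2) f2"
    "f2 = split_edge x y f1"
    using coords_child[OF data1 f2(1)] .
  obtain c d where cd: "verts K = {v, u, c, d}"
    using v verts by auto
  obtain f where f: "coords (verts K) f" "comb (verts K) f = comb (verts K1) f1"
    "f1 = split_edge v u f"
    using coords_child[OF marked_tetrahedron_imp_data(1)[OF K refedge v_neq_u cd] f1(1)] .
  have "thrice_coords K u v x y z w f f1 f2 h"
    by unfold_locales (use w f f1 f2 h h_eq in auto)
  then show thesis using that f(2) f1(2) f2(2) by simp
qed


lemma midpoint_eq_iff: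
  fixes a b c :: point
  shows "midpoint a b = midpoint a c \<longleftrightarrow> b = c" "midpoint b a = midpoint c a \<longleftrightarrow> b = c"
    "midpoint a b = midpoint c a \<longleftrightarrow> b = c" "midpoint b a = midpoint a c \<longleftrightarrow> b = c"
  by (auto simp: midpoint_def)

section \<open>The subdivision restricted to faces and edges\<close>

context thrice begin

lemma mark_cut_face:
  assumes "refedge K \<subseteq> F" "F \<in> faces (verts K)"
  shows "mark K F = {v, u}"
  using assms K refedge by (auto simp: marked_tetrahedron_def)

lemma faces_minus: 
  assumes "d \<in> verts K" "verts K - {d} = {a, b, c}"
  shows "{a, b, c} \<in> faces (verts K)" "distinct [a, b, c]"
proof -
  have "card (verts K) = 4" using K by (simp add: marked_tetrahedron_def)
  then have "card (verts K - {d}) = 3" using assms(1) by simp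
  then show "{a, b, c} \<in> faces (verts K)" "distinct [a, b, c]"
    using assms(2) by (auto simp: faces_def card_insert_if split: if_splits)
qed

text \<open>The face without \<open>u\<close> is the inherited one; a face with both
  \<open>u\<close> and \<open>v\<close> is marked by the refinement edge. For \<open>d = v\<close>
  nothing is said about the mark: \<open>K1\<close> meets that face only in its edge opposite
  \<open>u\<close>, on which the mark has no effect.\<close>

lemma marked_face_cases:
  assumes d: "d \<in> verts K" "verts K - {d} = {a, b, c}" and m: "mark K {a, b, c} = {a, b}"
  obtains "d = u" "{a, b} = {x, y}" "c = z"
  | "d = v"
  | "{a, b} = {v, u}" "v = x" "c = y" "d = z"
  | "{a, b} = {v, u}" "v = x" "c = z" "d = y"
  | "{a, b} = {v, u}" "v = y" "c = x" "d = z"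
  | "{a, b} = {v, u}" "v = y" "c = z" "d = x"
  | "{a, b} = {v, u}" "v = z" "c = x" "d = y"
  | "{a, b} = {v, u}" "v = z" "c = y" "d = x"
proof -
  note f = faces_minus[OF d]
  consider "d = u" | "d = v" | "d \<noteq> u" "d \<noteq> v" by blast
  then show thesis
  proof cases
    case 1
    then have e: "{a, b, c} = {x, y, z}" using d dist verts by auto
    then have ab: "{a, b} = {x, y}" using m mark_xyz by simp
    moreover have "c = z"
    proof -
      have "{a, b, c} - {a, b} = {c}" "{x, y, z} - {x, y} = {z}" using f(2) dist by auto
      then show ?thesis using e ab by simp
    qed
    ultimately show thesis using that(1) 1 by simp
  next
    case 2
    then show thesis using that(2) by simp
  next
    case 3
    have "{a, b, c} = verts K - {d}" using d by simp
    then have "refedge K \<subseteq> {a, b, c}" using 3 v refedge verts by auto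
    then have ab: "{a, b} = {v, u}" using mark_cut_face[OF _ f(1)] m by simp
    have "c \<in> verts K - {d}" "c \<notin> {a, b}" using d f(2) by auto
    then have "c \<in> {x, y, z}" "d \<in> {x, y, z}" "c \<noteq> v" "c \<noteq> d"
      using ab verts d(1) 3 by auto
    then show thesis using that(3-8)[OF ab] v 3 by blast
  qed
qed

lemma mark3:
  assumes "w \<in> {x, z}"
  shows "mark (child K2 w) {w, m1, m3} = {w, m1}" "mark (child K2 w) {w, m2, m3} = {w, m2}"
    "mark (child K2 w) {w, m1, m2} = (if w = z \<and> type_Pu K then {w, m2} else {w, m1})"
    "mark (child K2 w) {m1, m2, m3} = new_face_mark K2"
proof -
  have [simp]: "x \<noteq> z" using dist by simp
  have x: "mark (child K2 x) {x, m1, m3} = {x, m1} \<and> mark (child K2 x) {x, m2, m3} = {x, m2} \<and>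
    mark (child K2 x) {x, m1, m2} = {x, m1} \<and> mark (child K2 x) {m1, m2, m3} = new_face_mark K2"
    using data3x by (simp add: tet_data_def new_face_mark2)
  have z: "mark (child K2 z) {z, m1, m3} = {z, m1} \<and> mark (child K2 z) {z, m2, m3} = {z, m2} \<and>
    mark (child K2 z) {z, m1, m2} = (if type_Pu K then {z, m2} else {z, m1}) \<and>
    mark (child K2 z) {m1, m2, m3} = new_face_mark K2"
  proof (cases "type_Pu K")
    case True
    have "{z, m2, m1} = {z, m1, m2}" "{m2, m1, m3} = {m1, m2, m3}" by auto
    then show ?thesis using data3z(1)[OF True] True by (simp add: tet_data_def new_face_mark2)
  next
    case False
    then show ?thesis using data3z(2)[OF False] by (simp add: tet_data_def new_face_mark2)
  qed
  show "mark (child K2 w) {w, m1, m3} = {w, m1}" "mark (child K2 w) {w, m2, m3} = {w, m2}"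
    "mark (child K2 w) {w, m1, m2} = (if w = z \<and> type_Pu K then {w, m2} else {w, m1})"
    "mark (child K2 w) {m1, m2, m3} = new_face_mark K2"
    using assms x z by (elim insertE emptyE; simp)+
qed

lemma faces3_cases:
  assumes "w \<in> {x, z}" "F \<in> faces (verts (child K2 w))"
  shows "F \<in> {{w, m1, m2}, {w, m1, m3}, {w, m2, m3}, {m1, m2, m3}}"
proof -
  have "distinct [w, m1, m2, m3]" using assms dist_all by auto
  from faces_four[OF this] assms verts3[OF assms(1)] show ?thesis by simp
qed

end

context thrice_coords begin

lemma f_zero_imp: "a \<notin> {m1, m2} \<Longrightarrow> f a = 0 \<Longrightarrow> f1 a = 0 \<and> f2 a = 0"
  using f1_le[of a] f2_le[of a] nonneg by (metis insertCI order_antisym)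

text \<open>
  The right-hand side depends on the face carrying the point and on its mark only, not on the
  tetrahedron; this makes neighbouring subdivisions match.
\<close>

lemma h_eq_face_split:
  assumes d: "d \<in> verts K" "verts K - {d} = {a, b, c}" and m: "mark K {a, b, c} = {a, b}"
    and fd: "f d = 0"
  shows "h = face_split a b c f"
proof -
  note id = split_edge_id[OF nonneg(1)] split_edge_id[OF nonneg(2)] split_edge_id[OF nonneg(3)]
  note fs = faces_minus[OF d]
  have mid: "a \<noteq> midpoint b c" "c \<noteq> midpoint a b" "b \<noteq> midpoint a c"
    using midpoint_notin_verts fs d by auto
  \<comment> \<open>On a refinement face the first cut is the one leading from \<open>f\<close> to
    \<open>f1\<close>. It leaves no weight at \<open>u\<close>, so of the two later cuts only that
    of \<open>{v, c}\<close> can act.\<close>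
  have cut: "face_split a b c f = split_edge v c f1" if "{a, b} = {v, u}"
  proof -
    have "c \<noteq> u" using that fs(2) v_neq_u by auto
    have "u \<noteq> midpoint v c"
      using midpoint_notin_verts[of v c] that fs d verts v by auto
    then have "split_edge v c f1 u = 0"
      using zero_f1 nonneg by (intro split_edge_zero) auto
    then have "split_edge u c (split_edge v c f1) = split_edge v c f1"
      using nonneg split_edge_nonneg by (intro split_edge_id) auto
    moreover have "split_edge u c f1 = f1"
      using zero_f1 by (intro id) auto
    ultimately show ?thesis
      using that by (auto simp: doubleton_eq_iff face_split_def f1_eq split_edge_commute)
  qed
  have d0: "f1 d = 0" "f2 d = 0"
    using f_zero_imp[OF _ fd] dist_all d verts by auto
  show ?thesis
  proof (rule marked_face_cases[OF d m])
    assume A: "d = u" "{a, b} = {x, y}" "c = z"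
    have "f1 = f" using A fd id by (simp add: f1_eq)
    then have 1: "h = split_edge x z (split_edge x y f)" by (simp add: h_eq f2_eq)
    have "split_edge y z f2 = f2" using zero_f2 id by simp
    then have 2: "face_split x y z f = h"
      using 1 \<open>f1 = f\<close> f2_eq by (simp add: face_split_def)
    have "h y = 0"
      unfolding h_eq using zero_f2 nonneg dist_all by (intro split_edge_zero) auto
    then have "split_edge y z h = h" using nonneg by (intro split_edge_id) auto
    then have "face_split y x z f = h"
      using 1 by (simp add: face_split_def split_edge_commute[of y x])
    then show ?thesis using 2 A by (auto simp: doubleton_eq_iff)
  next
    assume A: "d = v"
    have f1f: "f1 = f" using A fd id by (simp add: f1_eq)
    have fu: "f u = 0" using zero_f1 f1f by simp
    have u: "u \<in> {a, b, c}" using A d v_neq_u verts by auto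
    have pick: "(a = u \<and> {b, c} = S) \<or> (b = u \<and> {a, c} = S) \<or> (c = u \<and> {a, b} = S)"
      if "{a, b, c} - {u} = S" for S
    proof -
      have "{a, b, c} - {a} = {b, c}" "{a, b, c} - {b} = {a, c}" "{a, b, c} - {c} = {a, b}"
        using fs(2) by auto
      then show ?thesis using u that by blast
    qed
    consider "v = x" | "v = y" | "v = z" using v by blast
    then show ?thesis
    proof cases
      case 1
      have "f2 = f" using id(1) fd A 1 by (simp add: f2_eq f1f)
      then have fy: "f y = 0" using zero_f2 by simp
      have "h = f" using id(1) fd A 1 by (simp add: h_eq \<open>f2 = f\<close>)
      have "y \<in> {a, b, c}" "u \<noteq> y" using d A 1 verts dist by auto
      then have "f a = 0 \<or> f b = 0" "f b = 0 \<or> f c = 0" "f a = 0 \<or> f c = 0"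
        using fu fy u by auto
      then have "face_split a b c f = f" using id(1) by (simp add: face_split_def)
      then show ?thesis using \<open>h = f\<close> by simp
    next
      case 2
      have "f2 = f" using id(1) fd A 2 by (simp add: f2_eq f1f)
      then have h: "h = split_edge x z f" by (simp add: h_eq)
      have "{a, b, c} - {u} = {x, z}"
        unfolding d(2)[symmetric] using A 2 verts dist by auto
      from pick[OF this] show ?thesis
        using face_split_zero[OF nonneg(1)] fu mid h
        by (auto simp: doubleton_eq_iff split_edge_commute)
    next
      case 3
      have "h = f2" using id(3) d0 A 3 by (simp add: h_eq)
      then have h: "h = split_edge x y f" by (simp add: f2_eq f1f)
      have "{a, b, c} - {u} = {x, y}"
        unfolding d(2)[symmetric] using A 3 verts dist by auto
      from pick[OF this] show ?thesis
        using face_split_zero[OF nonneg(1)] fu mid h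
        by (auto simp: doubleton_eq_iff split_edge_commute)
    qed
  next
    assume "{a, b} = {v, u}" "v = x" "c = y" "d = z"
    then show ?thesis using cut d0 id(3) by (simp add: h_eq f2_eq)
  next
    assume "{a, b} = {v, u}" "v = x" "c = z" "d = y"
    then show ?thesis using cut d0 id(2) by (simp add: h_eq f2_eq)
  next
    assume "{a, b} = {v, u}" "v = y" "c = x" "d = z"
    then show ?thesis using cut d0 id(3) by (simp add: h_eq f2_eq split_edge_commute)
  next
    assume A: "{a, b} = {v, u}" "v = y" "c = z" "d = x"
    have "f2 = f1" using A d0 id(2) by (simp add: f2_eq)
    then show ?thesis using A cut d0 id(2) zero_f2 by (simp add: h_eq)
  next
    assume "{a, b} = {v, u}" "v = z" "c = x" "d = y"
    then show ?thesis using cut d0 id(2) by (simp add: h_eq f2_eq split_edge_commute)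
  next
    assume A: "{a, b} = {v, u}" "v = z" "c = y" "d = x"
    have "f2 = f1" using A d0 id(2) by (simp add: f2_eq)
    then show ?thesis using A cut d0 id(2) zero_f2 by (simp add: h_eq)
  qed
qed

text \<open>Any face \<open>{r, s, t}\<close> through the edge will do: with no weight at
  \<open>r\<close>, each of the three possible marks reduces \<open>face_split\<close> to the cut of
  \<open>{s, t}\<close>.\<close>

lemma h_eq_split_edge:
  assumes "{s, t} \<subseteq> verts K" "s \<noteq> t" "\<And>a. a \<notin> {s, t} \<Longrightarrow> f a = 0"
  shows "h = split_edge s t f"
proof -
  have "card (verts K - {s, t}) = 2" using assms(1,2) verts dist by simp
  then obtain r d where rd: "verts K - {s, t} = {r, d}" "r \<noteq> d" by (auto simp: card_2_iff)
  have V: "d \<in> verts K" "verts K - {d} = {r, s, t}" using rd assms(1) by auto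
  have fr: "{r, s, t} \<in> faces (verts K)" "distinct [r, s, t]" using faces_minus[OF V] .
  then have "mark K {r, s, t} \<in> {{r, s}, {r, t}, {s, t}}"
    using K edges_three[OF fr(2)] by (auto simp: marked_tetrahedron_def)
  moreover have "f d = 0" "f r = 0" using assms(3) rd by auto
  moreover have "r \<noteq> midpoint s t" "r \<noteq> midpoint t s"
    using midpoint_notin_verts[of s t] assms(1,2) V by (auto simp: midpoint_sym)
  ultimately show ?thesis
    using h_eq_face_split[OF V(1), of r s t] h_eq_face_split[OF V(1), of r t s]
      h_eq_face_split[OF V(1), of s t r] V(2) face_split_zero[OF nonneg(1)]
    by (auto simp: insert_commute split_edge_commute)
qed

text \<open>Each of the four triangles of a subdivided face contains exactly one of the midpoints of
  its two unmarked edges, and the mark is the edge opposite to it. Removing both midpoints expresses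
  this without telling which triangle \<open>F\<close> is. Positivity of \<open>h\<close> on
  \<open>F\<close> and \<open>f d = 0\<close> place \<open>F\<close> in the face opposite
  \<open>d\<close>.\<close>

lemma outer_mark:
  assumes d: "d \<in> verts K" "verts K - {d} = {a, b, c}" and m: "mark K {a, b, c} = {a, b}"
    and fd: "f d = 0"
    and F: "F \<in> faces (verts (child K2 w))" "\<And>a. a \<in> F \<Longrightarrow> 0 < h a"
  shows "mark (child K2 w) F = F - {midpoint a c, midpoint b c}"
proof -
  note mk = mark3[OF w] 
  note F4 = faces3_cases[OF w F(1)]
  have Fd: "\<not> 0 < f d" using fd by simp
  have mid: "midpoint p q \<notin> {u, x, y, z}" if "p \<in> {u, x, y, z}" "q \<in> {u, x, y, z}" "p \<noteq> q" for p q
    using midpoint_notin_verts that verts by simp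
  have ne: "m1 \<noteq> w" "m2 \<noteq> w" "m3 \<noteq> w" "m1 \<noteq> m2" "m1 \<noteq> m3" "m2 \<noteq> m3"
    using dist_all w by auto
  have wuxyz: "w \<in> {u, x, y, z}" using w by auto
  have minus: "F - {midpoint a c, midpoint b c} = F - {midpoint v c, midpoint u c}" if "{a, b} = {v, u}"
    using that by (auto simp: doubleton_eq_iff)
  have wx: "w = x" if "d = z" using F4 F(2) pos Fd w that ne by auto
  have diff: "{p, q, r} - {r, s} = {p, q}" if "s \<notin> {p, q}" "r \<notin> {p, q}" for p q r s :: point
    using that by auto
  show ?thesis
  proof (rule marked_face_cases[OF d m])
    assume A: "d = u" "{a, b} = {x, y}" "c = z"
    have "m1 \<notin> F" using F(2) pos A Fd by blast
    then have F: "F = {w, m2, m3}" using F4 by auto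
    have "{midpoint a c, midpoint b c} = {m3, midpoint y z}"
      using A by (auto simp: doubleton_eq_iff)
    moreover have "midpoint y z \<noteq> m2" "midpoint y z \<noteq> w"
      using midpoint_eq_iff[of y] dist mid[of y z] w by auto
    ultimately show ?thesis using mk(2) diff[of "midpoint y z" w m2 m3] ne F by simp
  next
    assume A: "d = v"
    have "m1 \<notin> F" using F(2) pos A Fd by blast
    then have "F = {w, m2, m3}" using F4 by auto
    then have "0 < f x" "0 < f y" "0 < f z" using F(2) pos by auto
    then show ?thesis using A v Fd by auto
  next
    assume A: "{a, b} = {v, u}" "v = x" "c = y" "d = z"
    have "m3 \<notin> F" using F(2) pos A Fd by blast
    then have F: "F = {x, m1, m2}" and wx: "w = x" using F4 wx A by auto
    have "midpoint u y \<noteq> m1" "midpoint u y \<noteq> x"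
      using midpoint_eq_iff[of u] dist mid[of u y] A by auto
    then have "F - {m2, midpoint u y} = {x, m1}"
      unfolding F using ne wx by (intro diff) auto
    then show ?thesis
      unfolding minus[OF A(1)] using mk(3) dist wx A F by simp
  next
    assume A: "{a, b} = {v, u}" "v = x" "c = z" "d = y"
    have "m2 \<notin> F" using F(2) pos A Fd by blast
    then have F: "F = {w, m1, m3}" using F4 by auto
    have "midpoint u z \<noteq> m1" "midpoint u z \<noteq> w"
      using midpoint_eq_iff[of u] dist mid[of u z] wuxyz A by auto
    then have "F - {m3, midpoint u z} = {w, m1}"
      unfolding F using ne by (intro diff) auto
    then show ?thesis
      unfolding minus[OF A(1)] using mk(1) A F by simp
  next
    assume A: "{a, b} = {v, u}" "v = y" "c = x" "d = z"
    have "m3 \<notin> F" using F(2) pos A Fd by blast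
    then have F: "F = {x, m1, m2}" and wx: "w = x" using F4 wx A by auto
    have "midpoint u x \<noteq> m1" "midpoint u x \<noteq> x"
      using midpoint_eq_iff[of u] dist mid[of u x] A by auto
    then have "F - {m2, midpoint u x} = {x, m1}"
      unfolding F using ne wx by (intro diff) auto
    then show ?thesis
      unfolding minus[OF A(1)] using mk(3) dist wx A F by (simp add: midpoint_sym[of y x])
  next
    assume A: "{a, b} = {v, u}" "v = y" "c = z" "d = x"
    have "m2 \<notin> F" "m3 \<notin> F" using F(2) pos A Fd by blast+
    then show ?thesis using F4 by auto
  next
    assume A: "{a, b} = {v, u}" "v = z" "c = x" "d = y"
    have "m2 \<notin> F" using F(2) pos A Fd by blast
    then have F: "F = {w, m1, m3}" using F4 by auto
    have "midpoint u x \<noteq> m1" "midpoint u x \<noteq> w"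
      using midpoint_eq_iff[of u] dist mid[of u x] wuxyz A by auto
    then have "F - {m3, midpoint u x} = {w, m1}"
      unfolding F using ne by (intro diff) auto
    then show ?thesis
      unfolding minus[OF A(1)] using mk(1) A F by (simp add: midpoint_sym[of z x])
  next
    assume A: "{a, b} = {v, u}" "v = z" "c = y" "d = x"
    have "m2 \<notin> F" "m3 \<notin> F" using F(2) pos A Fd by blast+
    then show ?thesis using F4 by auto
  qed
qed

text \<open>In the last two bisections the new face of \<open>K\<close> is cut only through its old
  edge \<open>{p, q}\<close>. Since \<open>f1\<close> is symmetric in \<open>v\<close> and
  \<open>u\<close>, the same formula results on the other side of that face.\<close>

lemma h_eq_split_new_face:
  assumes "f1 v = 0" "{p, q} = {x, y, z} - {v}"
  shows "h = split_edge p q f1"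
proof -
  note id = split_edge_id[OF nonneg(2)] split_edge_id[OF nonneg(3)]
  have eq: "split_edge p q f1 = split_edge p' q' f1" if "{p', q'} = {x, y, z} - {v}" for p' q'
  proof -
    have "{p', q'} = {p, q}" using that assms(2) by simp
    then show ?thesis by (auto simp: doubleton_eq_iff split_edge_commute)
  qed
  have "h = split_edge y z f1" if "v = x"
  proof -
    have "f2 = f1" using id that assms(1) by (simp add: f2_eq)
    then show ?thesis using id zero_f2 that assms(1) by (simp add: h_eq)
  qed
  moreover have "h = split_edge x z f1" if "v = y"
    using id that assms(1) by (simp add: h_eq f2_eq)
  moreover have "h = split_edge x y f1" if "v = z"
  proof -
    have "f2 z = 0"
      unfolding f2_eq using that assms(1) dist_all nonneg by (intro split_edge_zero) auto
    then show ?thesis using id by (simp add: h_eq f2_eq)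
  qed
  moreover have "{x, y, z} - {x} = {y, z}" "{x, y, z} - {y} = {x, z}" "{x, y, z} - {z} = {x, y}"
    using dist by auto
  ultimately show ?thesis using eq[of y z] eq[of x z] eq[of x y] v by (elim insertE emptyE) simp_all
qed

lemma h_eq_f2: "f2 x = 0 \<Longrightarrow> h = f2"
  using split_edge_id[OF nonneg(3)] by (simp add: h_eq)

text \<open>Each half of the new face of \<open>K\<close> is a cut face, marked opposite the
  midpoint of \<open>{p, q}\<close>. Which bisection makes the cut depends on \<open>v\<close>; for
  \<open>v = x\<close> no face of this descendant lies there.\<close>

lemma mark_in_new_face:
  assumes "f1 v = 0" "{p, q} = {x, y, z} - {v}"
    and F: "F \<in> faces (verts (child K2 w))" "\<And>a. a \<in> F \<Longrightarrow> 0 < h a"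
  shows "mark (child K2 w) F = F - {midpoint p q}"
proof -
  note mk = mark3[OF w] 
  note F4 = faces3_cases[OF w F(1)]
  have Fv: "\<not> 0 < f1 v" using assms(1) by simp
  have "midpoint p q = midpoint p' q'" if "{p', q'} = {x, y, z} - {v}" for p' q'
  proof -
    have "{p', q'} = {p, q}" using that assms(2) by simp
    then show ?thesis by (auto simp: doubleton_eq_iff midpoint_sym)
  qed
  then have mid: "v = y \<Longrightarrow> midpoint p q = m3" "v = z \<Longrightarrow> midpoint p q = m2"
    using dist by auto
  have ne: "m1 \<noteq> w" "m2 \<noteq> w" "m3 \<noteq> w" "m1 \<noteq> m2" "m1 \<noteq> m3" "m2 \<noteq> m3"
    using dist_all w by auto
  consider "v = x" | "v = y" | "v = z" using v by blast
  then show ?thesis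
  proof cases
    case 1
    have "m2 \<notin> F" "m3 \<notin> F" using F(2) pos 1 Fv by blast+
    then show ?thesis using F4 by auto
  next
    case 2
    have "m2 \<notin> F" using F(2) pos 2 Fv by blast
    then have "F = {w, m1, m3}" using F4 by auto
    then show ?thesis using mk(1) ne mid(1)[OF 2] by auto
  next
    case 3
    have "m3 \<notin> F" "w = z \<Longrightarrow> w \<notin> F" using F(2) pos 3 Fv by blast+
    then have "F = {w, m1, m2}" "w \<noteq> z" using F4 by auto
    then show ?thesis using mk(3) ne mid(2)[OF 3] by auto
  qed
qed

text \<open>The new face \<open>{z, m1, m2}\<close> of \<open>K1\<close> does not contain the edge
  \<open>{x, z}\<close> that is cut last, so the descendant at \<open>z\<close> inherits it whole,
  with its mark.\<close>

lemma mark_in_new_face1: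
  assumes "f2 x = 0"
    and F: "F \<in> faces (verts (child K2 w))" "\<And>a. a \<in> F \<Longrightarrow> 0 < h a"
  shows "mark (child K2 w) F = new_face_mark K1"
proof -
  have Fx: "\<not> 0 < f2 x" using assms(1) by simp
  have "m3 \<notin> F" "w = x \<Longrightarrow> w \<notin> F" using F(2) pos Fx by blast+
  then have "F = {w, m1, m2}" "w = z" using faces3_cases[OF w F(1)] w by auto
  then show ?thesis using mark3(3)[OF w] new_face_mark1 by (auto simp: insert_commute)
qed

lemma mark_in_new_face2:
  assumes "F \<in> faces (verts (child K2 w))" "w \<notin> F"
  shows "mark (child K2 w) F = new_face_mark K2"
  using assms faces3_cases[OF w] mark3(4)[OF w] by auto

end


section \<open>Conformity of the uniform meshes\<close>

text \<open>The clause on coordinates says that two elements intersect in the convex hull of their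
  common vertices, in a form to which \<open>split_edge\<close> applies directly. The clause on
  vertex sets is separate because a mesh is a set of records, so that one tetrahedron could occur in
  it as several records.\<close>

definition admissible :: "marked_tet set \<Rightarrow> bool" where
  "admissible T \<longleftrightarrow>
     (\<forall>K\<in>T. marked_tetrahedron K \<and> \<not> flag K) \<and>
     (\<forall>K\<in>T. \<forall>L\<in>T. \<forall>f g. coords (verts K) f \<longrightarrow> coords (verts L) g \<longrightarrow>
        comb (verts K) f = comb (verts L) g \<longrightarrow> f = g) \<and>
     (\<forall>K\<in>T. \<forall>L\<in>T. verts K = verts L \<longrightarrow> K = L) \<and>
     (\<forall>K\<in>T. \<forall>L\<in>T. \<forall>F \<in> faces (verts K) \<inter> faces (verts L). mark K F = mark L F)"

lemma admissibleD:
  assumes "admissible T" "K \<in> T" "L \<in> T"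
  shows "marked_tetrahedron K" "\<not> flag K"
    "\<And>f g. coords (verts K) f \<Longrightarrow> coords (verts L) g \<Longrightarrow> comb (verts K) f = comb (verts L) g \<Longrightarrow> f = g"
    "verts K = verts L \<Longrightarrow> K = L"
    "\<And>F. F \<in> faces (verts K) \<Longrightarrow> F \<in> faces (verts L) \<Longrightarrow> mark K F = mark L F"
proof -
  note a = assms(1)[unfolded admissible_def]
  show "marked_tetrahedron K" "\<not> flag K"
    using a[THEN conjunct1] assms(2) by blast+
  show "\<And>f g. coords (verts K) f \<Longrightarrow> coords (verts L) g \<Longrightarrow> comb (verts K) f = comb (verts L) g \<Longrightarrow> f = g"
    using a[THEN conjunct2, THEN conjunct1, rule_format, OF assms(2,3)] by simp
  show "verts K = verts L \<Longrightarrow> K = L"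
    using a[THEN conjunct2, THEN conjunct2, THEN conjunct1, rule_format, OF assms(2,3)] by simp
  show "\<And>F. F \<in> faces (verts K) \<Longrightarrow> F \<in> faces (verts L) \<Longrightarrow> mark K F = mark L F"
    using a[THEN conjunct2, THEN conjunct2, THEN conjunct2, rule_format, OF assms(2,3)] by simp
qed

text \<open>After the cut of \<open>{s, t}\<close>, weight remains only at the midpoint and at one
  of the two endpoints, too few points for a triangle.\<close>

lemma (in thrice_coords) face_not_on_edge:
  assumes st: "{s, t} \<subseteq> verts K" "s \<noteq> t" "\<And>a. a \<notin> {s, t} \<Longrightarrow> f a = 0"
    and F: "F \<in> faces (verts (child K2 w))" "\<And>a. a \<in> F \<Longrightarrow> 0 < h a"
  shows False
proof -
  have h: "h = split_edge s t f" by (rule h_eq_split_edge[OF st])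
  have "F \<subseteq> {s, t, midpoint s t}"
  proof
    fix a assume "a \<in> F"
    then have "0 < split_edge s t f a" using F(2) h by simp
    then show "a \<in> {s, t, midpoint s t}"
      using st(3)[of a] split_edge_other[of a s t f] by force
  qed
  moreover have "s \<notin> F \<or> t \<notin> F"
    using split_edge_endpoint_zero[OF st(2), of f] F(2) h by force
  ultimately have "F \<subseteq> {s, midpoint s t} \<or> F \<subseteq> {t, midpoint s t}" by blast
  then have "card F \<le> 2"
  proof
    assume "F \<subseteq> {s, midpoint s t}"
    from card_mono[OF _ this] show ?thesis by (simp add: card_insert_if split: if_splits)
  next
    assume "F \<subseteq> {t, midpoint s t}"
    from card_mono[OF _ this] show ?thesis by (simp add: card_insert_if split: if_splits)
  qed
  then show False using F(1) by (simp add: faces_def)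
qed

lemma (in thrice) other_vertex:
  assumes "s \<in> verts K"
  obtains t where "{s, t} \<subseteq> verts K" "s \<noteq> t"
  using assms dist verts by (metis bot_least insert_iff insert_subset distinct_length_2_or_more)

text \<open>Two descendants with a common point are sorted by where their histories part. If they
  come from distinct elements, the point lies on the common face, edge or vertex; a parting at the
  first or second bisection puts it on the new face of \<open>K\<close> or of \<open>K1\<close>;
  otherwise the histories agree up to \<open>K2\<close>.\<close>

lemma descendants_cases:
  assumes T: "admissible T" "K \<in> T" "K' \<in> T"
    and 1: "thrice_coords K u v x y z w f f1 f2 h"
    and 2: "thrice_coords K' u' v' x' y' z' w' f f1' f2' h'"
  obtains
    (face) a b c d d' where "d \<in> verts K" "d' \<in> verts K'" "verts K - {d} = {a, b, c}"
      "verts K' - {d'} = {a, b, c}" "mark K {a, b, c} = {a, b}" "mark K' {a, b, c} = {a, b}"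
      "f d = 0" "f d' = 0"
  | (edge) s t where "{s, t} \<subseteq> verts K" "{s, t} \<subseteq> verts K'" "s \<noteq> t" "\<And>a. a \<notin> {s, t} \<Longrightarrow> f a = 0"
  | (vert) s where "s \<in> verts K" "s \<in> verts K'" "\<And>a. a \<noteq> s \<Longrightarrow> f a = 0"
  | (child0) p q where "f1 v = 0" "f1' v' = 0" "f1' = f1" "{p, q} = {x, y, z} - {v}"
      "{p, q} = {x', y', z'} - {v'}"
  | (child1) "f2 x = 0" "f2' x' = 0" "f2' = f2" "child K v = child K' v'"
  | (child2) "K' = K" "v' = v" "x' = x" "z' = z" "f2' = f2" "u' = u" "y' = y"
proof -
  interpret A: thrice_coords K u v x y z w f f1 f2 h by (rule 1)
  interpret B: thrice_coords K' u' v' x' y' z' w' f f1' f2' h' by (rule 2)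
  define C where "C = verts K \<inter> verts K'"
  have f0: "f a = 0" if "a \<notin> C" for a
    using that A.f B.f by (auto simp: C_def coords_def)
  have c4: "card (verts K) = 4" "card (verts K') = 4"
    using A.K B.K by (simp_all add: marked_tetrahedron_def)
  have fin: "finite (verts K)" "finite (verts K')" "finite C"
    using A.verts B.verts by (simp_all add: C_def)
  show thesis
  proof (cases "K = K'")
    case False
    then have ne: "verts K \<noteq> verts K'" using admissibleD(4)[OF T] by blast
    have "card C < 4"
    proof (rule ccontr)
      assume "\<not> card C < 4"
      then have "C = verts K" "C = verts K'"
        using c4 fin by (intro card_seteq; simp add: C_def)+
      then show False using ne by simp
    qed
    then consider "card C = 3" | "card C = 2" | "card C = 1" | "card C = 0" by linarith
    then show thesis
    proof cases
      case 1
      have "card (verts K - C) = 1" "card (verts K' - C) = 1"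
        using 1 c4 fin by (simp_all add: card_Diff_subset C_def)
      then obtain d d' where d: "verts K - C = {d}" "verts K' - C = {d'}"
        by (auto simp: card_1_singleton_iff)
      have CK: "verts K - {d} = C" "verts K' - {d'} = C"
        using d C_def by blast+
      have Cf: "C \<in> faces (verts K)" "C \<in> faces (verts K')"
        using 1 by (auto simp: faces_def C_def)
      then have "mark K C \<in> edges C" using A.K by (simp add: marked_tetrahedron_def)
      then obtain a b where ab: "mark K C = {a, b}" "a \<noteq> b" "{a, b} \<subseteq> C"
        by (auto simp: edges_def card_2_iff)
      have "card (C - {a, b}) = 1" using ab 1 fin by (simp add: card_Diff_subset)
      then obtain c where "C - {a, b} = {c}" by (auto simp: card_1_singleton_iff)
      then have C3: "C = {a, b, c}" using ab by blast
      show thesis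
      proof (rule face)
        show "d \<in> verts K" "d' \<in> verts K'" "f d = 0" "f d' = 0" using d f0 by blast+
        show "verts K - {d} = {a, b, c}" "verts K' - {d'} = {a, b, c}" using CK C3 by simp_all
        show "mark K {a, b, c} = {a, b}" "mark K' {a, b, c} = {a, b}"
          using ab(1) admissibleD(5)[OF T Cf] C3 by simp_all
      qed
    next
      case 2
      then obtain s t where "C = {s, t}" "s \<noteq> t" by (auto simp: card_2_iff)
      then show thesis using edge[of s t] f0 by (auto simp: C_def)
    next
      case 3
      then obtain s where "C = {s}" by (auto simp: card_1_singleton_iff)
      then show thesis using vert[of s] f0 by (auto simp: C_def)
    next
      case 4
      then have "C = {}" using fin by simp
      then have "sum f (verts K) = 0" using f0 by simp
      then show thesis using A.f by (simp add: coords_def)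
    qed
  next
    case True
    have e: "{v, u} = {v', u'}" using A.refedge B.refedge True by simp
    show thesis
    proof (cases "v' = v")
      case False
      then have s: "v' = u" "u' = v" using e by (auto simp: doubleton_eq_iff)
      \<comment> \<open>The two histories follow opposite ends of the refinement edge. The
        coordinates \<open>f1\<close> nevertheless agree and vanish at both ends, since each child
        lacks the endpoint of the other.\<close>
      have f1: "f1' = f1" using A.f1_eq B.f1_eq s split_edge_commute by simp
      have r: "{x, y, z} - {v} = verts K - {v, u}" "{x', y', z'} - {v'} = verts K - {v, u}"
        using A.verts B.verts A.dist B.dist s True by auto
      have "card (verts K - {v, u}) = 2"
      proof -
        have "{v, u} \<subseteq> verts K" using A.v A.verts by auto
        then show ?thesis using c4(1) A.v_neq_u by (simp add: card_Diff_subset)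
      qed
      then obtain p q where "verts K - {v, u} = {p, q}" by (auto simp: card_2_iff)
      then show thesis using child0[of p q] r f1 A.zero_f1 B.zero_f1 s by auto
    next
      case vv: True
      then have uu: "u' = u" using e A.v_neq_u by (auto simp: doubleton_eq_iff)
      have c: "child K' v' = child K v" using True vv by simp
      have f1: "f1' = f1" using A.f1_eq B.f1_eq vv uu by simp
      have e1: "{x', y'} = {x, y}" using A.refedge1 B.refedge1 c by simp
      have "{x, y, z} - {x, y} = {z}" "{x', y', z'} - {x', y'} = {z'}"
        using A.dist B.dist by auto
      moreover have "{x, y, z} = verts K - {u}" "{x', y', z'} = verts K - {u}"
        using A.verts B.verts A.dist B.dist uu True by auto
      ultimately have zz: "z' = z" using e1 by simp
      show thesis
      proof (cases "x' = x")
        case xx: True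
        then have yy: "y' = y" using e1 A.dist by (auto simp: doubleton_eq_iff)
        show thesis using child2 True vv uu xx yy zz f1 A.f2_eq B.f2_eq by simp
      next
        case False
        then have s: "x' = y" "y' = x" using e1 by (auto simp: doubleton_eq_iff)
        have "f2' = f2" using A.f2_eq B.f2_eq s f1 split_edge_commute by simp
        then show thesis using child1 s A.zero_f2 B.zero_f2 c by simp
      qed
    qed
  qed
qed

lemma descendants_conforming:
  assumes T: "admissible T" "K \<in> T" "K' \<in> T"
    and 1: "thrice_coords K u v x y z w f f1 f2 h"
    and 2: "thrice_coords K' u' v' x' y' z' w' f f1' f2' h'"
  shows "h = h'"
proof -
  interpret A: thrice_coords K u v x y z w f f1 f2 h by (rule 1)
  interpret B: thrice_coords K' u' v' x' y' z' w' f f1' f2' h' by (rule 2)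
  show ?thesis
  proof (rule descendants_cases[OF T 1 2], goal_cases)
    case 1
    then show ?case using A.h_eq_face_split B.h_eq_face_split by metis
  next
    case (2 s t)
    then show ?case using A.h_eq_split_edge[of s t] B.h_eq_split_edge[of s t] by simp
  next
    case (3 s)
    have "h = f"
    proof -
      obtain t where "{s, t} \<subseteq> verts K" "s \<noteq> t" using A.other_vertex 3(1) .
      then show ?thesis
        using A.h_eq_split_edge[of s t] 3(3) split_edge_id[OF A.nonneg(1)] by auto
    qed
    moreover have "h' = f"
    proof -
      obtain t where "{s, t} \<subseteq> verts K'" "s \<noteq> t" using B.other_vertex 3(2) .
      then show ?thesis
        using B.h_eq_split_edge[of s t] 3(3) split_edge_id[OF A.nonneg(1)] by auto
    qed
    ultimately show ?case by simp
  next
    case (4 p q)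
    then show ?case using A.h_eq_split_new_face[of p q] B.h_eq_split_new_face[of p q] by simp
  next
    case 5
    then show ?case using A.h_eq_f2 B.h_eq_f2 by simp
  next
    case 6
    then show ?case using A.h_eq B.h_eq by simp
  qed
qed

lemma descendants_same_mark:
  assumes T: "admissible T" "K \<in> T" "K' \<in> T"
    and 1: "thrice_coords K u v x y z w f f1 f2 h"
    and 2: "thrice_coords K' u' v' x' y' z' w' f f1' f2' h"
    and F: "F \<in> faces (verts (child (child (child K v) x) w))"
      "F \<in> faces (verts (child (child (child K' v') x') w'))" "\<And>a. a \<in> F \<Longrightarrow> 0 < h a"
  shows "mark (child (child (child K v) x) w) F = mark (child (child (child K' v') x') w') F"
proof -
  interpret A: thrice_coords K u v x y z w f f1 f2 h by (rule 1)
  interpret B: thrice_coords K' u' v' x' y' z' w' f f1' f2' h by (rule 2)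
  show ?thesis
  proof (rule descendants_cases[OF T 1 2], goal_cases)
    case (1 a b c d d')
    then show ?case
      using A.outer_mark[OF 1(1,3,5,7) F(1,3)] B.outer_mark[OF 1(2,4,6,8) F(2,3)] by simp
  next
    case (2 s t)
    then show ?case using A.face_not_on_edge[of s t] F by blast
  next
    case (3 s)
    obtain t where "{s, t} \<subseteq> verts K" "s \<noteq> t" using A.other_vertex 3(1) .
    then show ?case using A.face_not_on_edge[of s t] F 3(3) by blast
  next
    case (4 p q)
    then show ?case
      using A.mark_in_new_face[of p q, OF _ _ F(1,3)] B.mark_in_new_face[of p q, OF _ _ F(2,3)] by simp
  next
    case 5
    then show ?case
      using A.mark_in_new_face1[OF _ F(1,3)] B.mark_in_new_face1[OF _ F(2,3)] by simp
  next
    case 6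
    show ?case
    proof (cases "w' = w")
      case True
      then show ?thesis using 6 by simp
    next
      case False
      have "w \<notin> verts (child (child (child K' v') x') w')" "w' \<notin> verts (child (child (child K v) x) w)"
      proof -
        have "w \<notin> {w', A.m1, A.m2, A.m3}" "w' \<notin> {w, A.m1, A.m2, A.m3}"
          using False A.w B.w[unfolded 6(3,4)] A.midpoints_neq by blast+
        then show "w \<notin> verts (child (child (child K' v') x') w')"
          "w' \<notin> verts (child (child (child K v) x) w)"
          unfolding A.verts3[OF A.w] B.verts3[OF B.w] using 6 by simp_all
      qed
      \<comment> \<open>A common face of the two last siblings contains neither end of the edge cut
        last, so it is the new face of \<open>K2\<close>.\<close>
      then have "w \<notin> F" "w' \<notin> F" using F(1,2) by (auto simp: faces_def)
      then show ?thesis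
        using A.mark_in_new_face2[OF F(1)] B.mark_in_new_face2[OF F(2)] 6 by simp
    qed
  qed
qed

text \<open>Equality of records includes the values of \<open>mark\<close> off the faces, which
  agreement of the marks on faces does not give. So both descendants are shown to arise from the
  same element by the same choices: with positive weight at every vertex, the point lies on no face
  along which histories could part.\<close>

lemma descendants_same_verts:
  assumes T: "admissible T" "K \<in> T" "K' \<in> T"
    and 1: "thrice_coords K u v x y z w f f1 f2 h"
    and 2: "thrice_coords K' u' v' x' y' z' w' f f1' f2' h"
    and V: "verts (child (child (child K v) x) w) = verts (child (child (child K' v') x') w')"
      "\<And>a. a \<in> verts (child (child (child K v) x) w) \<Longrightarrow> 0 < h a"
  shows "child (child (child K v) x) w = child (child (child K' v') x') w'"
proof -
  interpret A: thrice_coords K u v x y z w f f1 f2 h by (rule 1)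
  interpret B: thrice_coords K' u' v' x' y' z' w' f f1' f2' h by (rule 2)
  have "0 < h A.m1" "0 < h A.m2" "0 < h A.m3" using V(2) A.verts3[OF A.w] by auto
  then have pos: "0 < f u" "0 < f x" "0 < f y" "0 < f z" "0 < f1 x" "0 < f1 y" "0 < f1 z" "0 < f2 x"
    using A.pos by blast+
  then have posK: "0 < f a" if "a \<in> verts K" for a using that A.verts by auto
  show ?thesis
  proof (rule descendants_cases[OF T 1 2], goal_cases)
    case (1 a b c d d')
    then show ?case using posK[of d] by simp
  next
    case (2 s t)
    have "\<exists>a \<in> verts K. a \<notin> {s, t}" using A.dist A.verts by auto
    then show ?case using posK 2(4) by fastforce
  next
    case (3 s)
    have "\<exists>a \<in> verts K. a \<noteq> s" using A.dist A.verts by auto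
    then show ?case using posK 3(3) by fastforce
  next
    case 4
    have "0 < f1 v" using pos(5-7) A.v by blast
    then show ?case using 4(1) by simp
  next
    case 5
    then show ?case using pos by simp
  next
    case 6
    have "w \<in> verts (child (child (child K' v') x') w')"
      unfolding V(1)[symmetric] A.verts3[OF A.w] by simp
    then have "w \<in> {w', A.m1, A.m2, A.m3}"
      unfolding B.verts3[OF B.w] unfolding 6 .
    moreover have "w \<notin> {A.m1, A.m2, A.m3}" using A.w A.midpoints_neq by blast
    ultimately have "w' = w" by blast
    then show ?case using 6 by simp
  qed
qed

text \<open>The barycenter of a common face, or of a common vertex set, is a single test point with
  positive weight at each vertex. It turns statements about shared faces into statements about one
  point.\<close>

definition barycenter_coords :: "point set \<Rightarrow> point \<Rightarrow> real" where
  "barycenter_coords A = (\<lambda>v. if v \<in> A then 1 / card A else 0)"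

lemma coords_barycenter:
  assumes "A \<subseteq> B" "finite B" "A \<noteq> {}"
  shows "coords B (barycenter_coords A)" "comb B (barycenter_coords A) = comb A (barycenter_coords A)"
    "a \<in> A \<Longrightarrow> 0 < barycenter_coords A a"
proof -
  have fin: "finite A" using assms finite_subset by blast
  have "sum (barycenter_coords A) B = sum (barycenter_coords A) A"
    using assms by (intro sum.mono_neutral_right) (auto simp: barycenter_coords_def)
  also have "\<dots> = 1" using fin assms by (simp add: barycenter_coords_def)
  finally show "coords B (barycenter_coords A)"
    using assms by (auto simp: coords_def barycenter_coords_def)
  show "comb B (barycenter_coords A) = comb A (barycenter_coords A)"
    unfolding comb_def using assms by (intro sum.mono_neutral_right) (auto simp: barycenter_coords_def)
  show "0 < barycenter_coords A a" if "a \<in> A"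
    using that fin by (auto simp: barycenter_coords_def card_gt_0_iff)
qed

lemma admissible_bisect_all:
  assumes T: "admissible T"
  shows "admissible (bisect_all (bisect_all (bisect_all T)))" (is "admissible ?T'")
proof -
  have ok: "marked_tetrahedron K \<and> \<not> flag K" if "K \<in> T" for K
    using admissibleD[OF T that that] by simp
  have ok': "marked_tetrahedron M \<and> \<not> flag M" if M': "M \<in> ?T'" for M
  proof -
    obtain K u v x y z w where M: "K \<in> T" "thrice K u v x y z" "w \<in> {x, z}"
      "M = child (child (child K v) x) w"
      using thrice_bisect_all_cases[OF M' ok] .
    interpret thrice K u v x y z by (rule M(2))
    show ?thesis using marked_tetrahedron3[OF M(3)] unflagged3 M(4) by simp
  qed
  \<comment> \<open>Coordinates in both descendants are pulled back to elements of \<open>T\<close>,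
    where uniqueness identifies them; so both chains start from one and the same
    \<open>f\<close>.\<close>
  have step: "\<exists>K K' u v x y z w u' v' x' y' z' w' f f1 f2 f1' f2'. K \<in> T \<and> K' \<in> T \<and>
      M = child (child (child K v) x) w \<and> M' = child (child (child K' v') x') w' \<and>
      thrice_coords K u v x y z w f f1 f2 h \<and> thrice_coords K' u' v' x' y' z' w' f f1' f2' h'"
    if M: "M \<in> ?T'" "M' \<in> ?T'" and h: "coords (verts M) h" "coords (verts M') h'"
      "comb (verts M) h = comb (verts M') h'" for M M' h h'
  proof -
    obtain K u v x y z w where M1: "K \<in> T" "thrice K u v x y z" "w \<in> {x, z}"
      "M = child (child (child K v) x) w"
      using thrice_bisect_all_cases[OF M(1) ok] .
    obtain K' u' v' x' y' z' w' where M2: "K' \<in> T" "thrice K' u' v' x' y' z'" "w' \<in> {x', z'}"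
      "M' = child (child (child K' v') x') w'"
      using thrice_bisect_all_cases[OF M(2) ok] .
    obtain f f1 f2 where f: "thrice_coords K u v x y z w f f1 f2 h" "comb (verts K) f = comb (verts M) h"
      using thrice.coords_descendant[OF M1(2,3)] h M1(4) by metis
    obtain f' f1' f2' where f': "thrice_coords K' u' v' x' y' z' w' f' f1' f2' h'"
      "comb (verts K') f' = comb (verts M') h'"
      using thrice.coords_descendant[OF M2(2,3)] h M2(4) by metis
    have "f = f'"
      using admissibleD(3)[OF T M1(1) M2(1)] thrice_coords.f[OF f(1)] thrice_coords.f[OF f'(1)] f f' h
      by simp
    then show ?thesis using M1 M2 f f' by blast
  qed
  have "h = h'" if "M \<in> ?T'" "M' \<in> ?T'" "coords (verts M) h" "coords (verts M') h'"
      "comb (verts M) h = comb (verts M') h'" for M M' h h'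
    using step[OF that] by (elim exE conjE) (rule descendants_conforming[OF T]; assumption)
  moreover have "mark M F = mark M' F" if M: "M \<in> ?T'" "M' \<in> ?T'"
    and F: "F \<in> faces (verts M)" "F \<in> faces (verts M')" for M M' F
  proof -
    let ?h = "barycenter_coords F"
    have "F \<subseteq> verts M" "F \<subseteq> verts M'" "F \<noteq> {}" using F by (auto simp: faces_def)
    then have h: "coords (verts M) ?h" "coords (verts M') ?h" "comb (verts M) ?h = comb (verts M') ?h"
      "\<And>a. a \<in> F \<Longrightarrow> 0 < ?h a"
      using coords_barycenter finite_verts ok' M by simp_all
    obtain K K' u v x y z w u' v' x' y' z' w' f f1 f2 f1' f2' where
      D: "K \<in> T" "K' \<in> T" "thrice_coords K u v x y z w f f1 f2 ?h"
        "thrice_coords K' u' v' x' y' z' w' f f1' f2' ?h" and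
      MM: "M = child (child (child K v) x) w" "M' = child (child (child K' v') x') w'"
      using step[OF M h(1-3)] by (elim exE conjE) (rule that; assumption)
    show ?thesis
      unfolding MM by (rule descendants_same_mark[OF T D]) (use F h(4) MM in auto)
  qed
  moreover have "M = M'" if M: "M \<in> ?T'" "M' \<in> ?T'" and V: "verts M = verts M'" for M M'
  proof -
    define h where "h = barycenter_coords (verts M)"
    have "marked_tetrahedron M" using ok' M by simp
    then have "finite (verts M)" "verts M \<noteq> {}"
      by (auto simp: finite_verts marked_tetrahedron_def)
    then have h: "coords (verts M) h" "coords (verts M') h" "comb (verts M) h = comb (verts M') h"
      "\<And>a. a \<in> verts M \<Longrightarrow> 0 < h a"
      using coords_barycenter[of "verts M" "verts M"] V by (simp_all add: h_def)
    obtain K K' u v x y z w u' v' x' y' z' w' f f1 f2 f1' f2' where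
      D: "K \<in> T" "K' \<in> T" "thrice_coords K u v x y z w f f1 f2 h"
        "thrice_coords K' u' v' x' y' z' w' f f1' f2' h" and
      MM: "M = child (child (child K v) x) w" "M' = child (child (child K' v') x') w'"
      using step[OF M h(1-3)] by (elim exE conjE) (rule that; assumption)
    show ?thesis
      unfolding MM
      by (rule descendants_same_verts[OF T D V[unfolded MM]]) (rule h(4)[unfolded MM(1)])
  qed
  ultimately show ?thesis
    using ok' unfolding admissible_def by blast
qed


section \<open>The initial mesh and the induction over uniform meshes\<close>

lemma comb_in_convex_hull:
  assumes "coords A f" "finite A"
  shows "comb A f \<in> convex hull A"
  using assms by (auto simp: coords_def comb_def convex_hull_finite)

lemma convex_hull_imp_coords:
  assumes "p \<in> convex hull S" "S \<subseteq> A" "finite A"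
  obtains f where "coords S f" "coords A f" "comb A f = p" "comb S f = p"
proof -
  have fin: "finite S" using assms finite_subset by blast
  then obtain g where g: "\<forall>x\<in>S. 0 \<le> g x" "sum g S = 1" "(\<Sum>x\<in>S. g x *\<^sub>R x) = p"
    using assms(1) by (auto simp: convex_hull_finite)
  define f where "f = (\<lambda>v. if v \<in> S then g v else 0)"
  have "sum f S = 1" "comb S f = p"
    using g by (simp_all add: f_def comb_def)
  moreover have "sum f A = sum f S"
    using assms by (intro sum.mono_neutral_right) (auto simp: f_def)
  moreover have "comb A f = comb S f"
    unfolding comb_def using assms by (intro sum.mono_neutral_right) (auto simp: f_def)
  moreover have "\<forall>v. 0 \<le> f v" "\<forall>v. v \<notin> S \<longrightarrow> f v = 0"
    using g(1) by (auto simp: f_def)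
  ultimately show thesis using that[of f] assms(2) by (auto simp: coords_def)
qed

text \<open>A common point of two distinct elements lies in the convex hull of shared vertices
  \<open>S\<close>. Both coordinate functions are therefore its coordinates in \<open>S\<close>, and
  these are unique because \<open>S\<close> is affinely independent.\<close>

lemma admissible_initial_mesh:
  assumes "initial_mesh T"
  shows "admissible T"
proof -
  have mt: "marked_tetrahedron K" "\<not> flag K" if "K \<in> T" for K
    using assms that by (auto simp: initial_mesh_def marked_mesh_def)
  have ind: "\<not> affine_dependent (verts K)" "finite (verts K)" "card (verts K) = 4" if "K \<in> T" for K
    using mt[OF that] finite_verts by (auto simp: marked_tetrahedron_def)
  have cm: "conformingly_marked T" using assms by (simp add: initial_mesh_def)
  have conf: "\<exists>S. S \<subseteq> verts K \<inter> verts L \<and> card S \<le> 3 \<and> tet K \<inter> tet L = convex hull S"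
    if "K \<in> T" "L \<in> T" "K \<noteq> L" for K L
    using cm[unfolded conformingly_marked_def conforming_def, THEN conjunct1, rule_format, OF that] .
  have "f = g" if KL: "K \<in> T" "L \<in> T" and f: "coords (verts K) f" and g: "coords (verts L) g"
    and eq: "comb (verts K) f = comb (verts L) g" for K L f g
  proof (cases "K = L")
    case True
    then show ?thesis using coords_unique[OF ind(1,2)] KL f g eq by blast
  next
    case False
    from conf[OF KL False] obtain S where
      S: "S \<subseteq> verts K \<inter> verts L" "tet K \<inter> tet L = convex hull S" by blast
    have "comb (verts K) f \<in> tet K \<inter> tet L"
      using comb_in_convex_hull[OF f ind(2)] comb_in_convex_hull[OF g ind(2)] KL eq
      by (simp add: tet_def)
    then have p: "comb (verts K) f \<in> convex hull S" using S(2) by simp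
    have SK: "S \<subseteq> verts K" "S \<subseteq> verts L" using S(1) by auto
    obtain k where k: "coords S k" "coords (verts K) k" "comb (verts K) k = comb (verts K) f"
      "comb S k = comb (verts K) f"
      using convex_hull_imp_coords[OF p SK(1) ind(2)[OF KL(1)]] .
    obtain l where l: "coords S l" "coords (verts L) l" "comb (verts L) l = comb (verts K) f"
      "comb S l = comb (verts K) f"
      using convex_hull_imp_coords[OF p SK(2) ind(2)[OF KL(2)]] .
    have "f = k" using coords_unique[OF ind(1,2) f k(2)] KL k by simp
    moreover have "g = l" using coords_unique[OF ind(1,2) g l(2)] KL l eq by simp
    moreover have "k = l"
    proof (rule coords_unique[OF _ _ k(1) l(1)])
      show "\<not> affine_dependent S" using affine_independent_subset ind(1) KL(1) SK(1) by blast
      show "finite S" using finite_subset ind(2) KL(1) SK(1) by blast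
    qed (use k l in simp)
    ultimately show ?thesis by simp
  qed
  moreover have "K = L" if KL: "K \<in> T" "L \<in> T" and V: "verts K = verts L" for K L
  proof (rule ccontr)
    assume "K \<noteq> L"
    from conf[OF KL this] obtain S where
      S: "S \<subseteq> verts K" "card S \<le> 3" "tet K = convex hull S"
      using V by (auto simp: tet_def)
    \<comment> \<open>Four vertices do not fit into \<open>S\<close>; the one left out would lie in
      the convex hull of the other three.\<close>
    obtain a where a: "a \<in> verts K" "a \<notin> S"
      using card_mono[of S "verts K"] S(1,2) ind(2,3)[OF KL(1)] finite_subset by fastforce
    have "a \<in> convex hull S" using a(1) S(3) by (metis hull_inc tet_def)
    moreover have "S \<subseteq> verts K - {a}" using a S(1) by auto
    ultimately have "a \<in> affine hull (verts K - {a})"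
      by (meson convex_hull_subset_affine_hull hull_mono subsetD)
    then show False using ind(1)[OF KL(1)] a(1) by (auto simp: affine_dependent_def)
  qed
  moreover have "mark K F = mark L F" if "K \<in> T" "L \<in> T" "F \<in> faces (verts K) \<inter> faces (verts L)" for K L F
    using cm[unfolded conformingly_marked_def, THEN conjunct2, rule_format, OF that] .
  ultimately show ?thesis
    using mt unfolding admissible_def by blast
qed

lemma uniform_mesh_Suc:
  "uniform_mesh T0 (Suc q) = bisect_all (bisect_all (bisect_all (uniform_mesh T0 q)))"
proof -
  have "3 * Suc q = Suc (Suc (Suc (3 * q)))" by simp
  then show ?thesis unfolding uniform_mesh_def by (simp only: funpow.simps comp_apply)
qed

lemma admissible_uniform_mesh:
  assumes "initial_mesh T0"
  shows "admissible (uniform_mesh T0 q)"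
proof (induction q)
  case 0
  then show ?case using admissible_initial_mesh[OF assms] by (simp add: uniform_mesh_def)
next
  case (Suc q)
  then show ?case unfolding uniform_mesh_Suc by (rule admissible_bisect_all)
qed

text \<open>The index is \<open>Suc q\<close> because the initial mesh may contain elements of types
  O and M, which the first three bisections remove.\<close>

lemma uniform_mesh_type:
  assumes "initial_mesh T0" "K \<in> uniform_mesh T0 (Suc q)"
  shows "type_A K \<or> type_Pu K"
proof -
  have "\<And>K. K \<in> uniform_mesh T0 q \<Longrightarrow> marked_tetrahedron K \<and> \<not> flag K"
    using admissible_uniform_mesh[OF assms(1)] admissibleD by blast
  from thrice_bisect_all_cases[OF assms(2)[unfolded uniform_mesh_Suc] this]
  show ?thesis using thrice.type3 by metis
qed

section \<open>Midpoints of edges across the mesh\<close>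

definition mid_coords :: "point \<Rightarrow> point \<Rightarrow> point \<Rightarrow> real" where
  "mid_coords a b = (\<lambda>v. (if v = a then 1/2 else 0) + (if v = b then 1/2 else 0))"

lemma mid_coords:
  assumes "a \<in> A" "b \<in> A" "finite A"
  shows "coords A (mid_coords a b)" "comb A (mid_coords a b) = midpoint a b"
proof -
  show "coords A (mid_coords a b)"
    using assms by (auto simp: coords_def mid_coords_def sum.distrib)
  have "comb A (mid_coords a b) = (\<Sum>v\<in>A. (if v = a then (1/2) *\<^sub>R v else 0) + (if v = b then (1/2) *\<^sub>R v else 0))"
    unfolding comb_def by (intro sum.cong) (auto simp: mid_coords_def algebra_simps)
  also have "\<dots> = midpoint a b"
    using assms by (simp add: sum.distrib midpoint_def algebra_simps)
  finally show "comb A (mid_coords a b) = midpoint a b" .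
qed

lemma mid_coords_eq_imp: "mid_coords a b = mid_coords c d \<Longrightarrow> {a, b} = {c, d}"
proof -
  have "{v. mid_coords p q v \<noteq> 0} = {p, q}" for p q by (auto simp: mid_coords_def)
  then show "mid_coords a b = mid_coords c d \<Longrightarrow> {a, b} = {c, d}" by metis
qed

lemma midpoint_eq_imp:
  assumes "admissible T" "K \<in> T" "L \<in> T" "{a, b} \<subseteq> verts K" "{c, d} \<subseteq> verts L"
    "midpoint a b = midpoint c d"
  shows "{a, b} = {c, d}"
proof -
  have "finite (verts K)" "finite (verts L)"
    using admissibleD(1)[OF assms(1)] assms(2,3) finite_verts by auto
  then have "mid_coords a b = mid_coords c d"
    using admissibleD(3)[OF assms(1-3)] mid_coords assms(4-6) by simp
  then show ?thesis by (rule mid_coords_eq_imp)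
qed

text \<open>A vertex \<open>c\<close> is the degenerate midpoint of \<open>c\<close> and
  \<open>c\<close>. This is why \<open>mid_coords\<close> adds two indicator terms:
  \<open>mid_coords c c\<close> puts both halves on \<open>c\<close>.\<close>

lemma midpoint_neq_vertex:
  assumes "admissible T" "K \<in> T" "L \<in> T" "{a, b} \<subseteq> verts K" "a \<noteq> b" "c \<in> verts L"
  shows "midpoint a b \<noteq> c"
  using midpoint_eq_imp[OF assms(1-4), of c c] assms(5,6) by auto


section \<open>Edge classes\<close>

lemma type_A_not_Pu: "type_A K \<Longrightarrow> \<not> type_Pu K"
  by (simp add: type_A_def type_Pu_def)

lemma mid_refedge:
  assumes "marked_tetrahedron K"
  obtains a b c d where "tet_data K a b c d (mark K {a, c, d}) (mark K {b, c, d})"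
    "mid (refedge K) = midpoint a b" "mid (verts K - refedge K) = midpoint c d"
proof -
  have K: "card (verts K) = 4" "refedge K \<subseteq> verts K" "card (refedge K) = 2"
    using assms by (auto simp: marked_tetrahedron_def edges_def)
  then have "card (verts K - refedge K) = 2"
    by (simp add: card_Diff_subset finite_verts assms finite_subset)
  then obtain c d where cd: "verts K - refedge K = {c, d}" "c \<noteq> d" by (auto simp: card_2_iff)
  obtain a b where ab: "refedge K = {a, b}" "a \<noteq> b" using K(3) by (auto simp: card_2_iff)
  have "verts K = {a, b, c, d}" using cd ab K(2) by blast
  from marked_tetrahedron_imp_data(1)[OF assms ab this] that ab cd
  show thesis by (simp add: mid_pair)
qed

context
  fixes T
  assumes T: "admissible T"
begin

text \<open>What separates \<open>cH\<close> from \<open>cV\<close> is only the incidence of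
  \<open>s\<close> with \<open>{a, b}\<close>, which does not depend on the tetrahedron that
  exhibits the edge.\<close>

lemma has_class_vertexE:
  assumes "has_class T e c" "c = cH \<or> c = cV"
  obtains K s a b where "K \<in> T" "{s, a, b} \<subseteq> verts K" "a \<noteq> b" "e = {s, midpoint a b}"
    "s \<in> {a, b} \<longleftrightarrow> c = cH"
proof -
  from assms(2) show thesis
  proof
    assume c: "c = cH"
    then obtain K a b where "K \<in> T" "{a, b} \<in> edges (verts K)" "e = {a, midpoint a b}"
      using assms(1) by auto
    moreover then have "a \<noteq> b" by (auto simp: edges_def)
    ultimately show thesis using that[of K a a b] c by (auto simp: edges_def)
  next
    assume c: "c = cV"
    then obtain K a b s where "K \<in> T" "{a, b, s} \<in> faces (verts K)" "e = {s, midpoint a b}"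
      using assms(1) by auto
    moreover then have "distinct [a, b, s]"
      by (auto simp: faces_def card_insert_if split: if_splits)
    ultimately show thesis using that[of K s a b] c by (auto simp: faces_def)
  qed
qed

text \<open>The other classes join the midpoints of two edges of one tetrahedron. In class
  \<open>cMf\<close> these edges meet; otherwise they are opposite, so their endpoints make up the
  whole tetrahedron, whose type then separates \<open>cIA\<close> from \<open>cIP\<close>.\<close>

lemma has_class_midpointsE:
  assumes "has_class T e k" "k \<noteq> cH" "k \<noteq> cV"
  obtains K p q r s where "K \<in> T" "{p, q, r, s} \<subseteq> verts K" "p \<noteq> q" "r \<noteq> s"
    "e = {midpoint p q, midpoint r s}" "{p, q} \<inter> {r, s} \<noteq> {} \<longleftrightarrow> k = cMf"
    "k = cIA \<Longrightarrow> {p, q, r, s} = verts K \<and> type_A K"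
    "k = cIP \<Longrightarrow> {p, q, r, s} = verts K \<and> type_Pu K"
proof (cases k)
  case cMf
  then obtain K a b c where "K \<in> T" "{a, b, c} \<in> faces (verts K)" "e = {midpoint a b, midpoint a c}"
    using assms(1) by auto
  moreover then have "distinct [a, b, c]"
    by (auto simp: faces_def card_insert_if split: if_splits)
  ultimately show thesis using that[of K a b a c] cMf by (auto simp: faces_def)
next
  case cIA
  then obtain K where K: "K \<in> T" "type_A K" "e = {mid (refedge K), mid (verts K - refedge K)}"
    using assms(1) by auto
  obtain a b c d where D: "tet_data K a b c d (mark K {a, c, d}) (mark K {b, c, d})"
    and m: "mid (refedge K) = midpoint a b" "mid (verts K - refedge K) = midpoint c d"
    using mid_refedge admissibleD(1)[OF T K(1) K(1)] .
  have V: "verts K = {a, b, c, d}" "distinct [a, b, c, d]"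
    using D by (simp_all add: tet_data_def)
  show thesis
  proof (rule that)
    show "K \<in> T" "e = {midpoint a b, midpoint c d}" using K m by simp_all
    show "{a, b, c, d} \<subseteq> verts K" "{a, b} \<inter> {c, d} \<noteq> {} \<longleftrightarrow> k = cMf" "a \<noteq> b" "c \<noteq> d"
      using V cIA by auto
  qed (use V K cIA in simp_all)
next
  case cIP
  then obtain K where K: "K \<in> T" "type_Pu K" "e = {mid (refedge K), mid (verts K - refedge K)}"
    using assms(1) by auto
  obtain a b c d where D: "tet_data K a b c d (mark K {a, c, d}) (mark K {b, c, d})"
    and m: "mid (refedge K) = midpoint a b" "mid (verts K - refedge K) = midpoint c d"
    using mid_refedge admissibleD(1)[OF T K(1) K(1)] .
  have V: "verts K = {a, b, c, d}" "distinct [a, b, c, d]"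
    using D by (simp_all add: tet_data_def)
  show thesis
  proof (rule that)
    show "K \<in> T" "e = {midpoint a b, midpoint c d}" using K m by simp_all
    show "{a, b, c, d} \<subseteq> verts K" "{a, b} \<inter> {c, d} \<noteq> {} \<longleftrightarrow> k = cMf" "a \<noteq> b" "c \<noteq> d"
      using V cIP by auto
  qed (use V K cIP in simp_all)
qed (use assms in simp_all)

lemma midpoint_pairs_eq:
  assumes "K \<in> T" "L \<in> T" "{p, q, r, s} \<subseteq> verts K" "{p', q', r', s'} \<subseteq> verts L"
    "{midpoint p q, midpoint r s} = {midpoint p' q', midpoint r' s'}"
  shows "{{p, q}, {r, s}} = {{p', q'}, {r', s'}}"
proof -
  have imp: "{a, b} = {c, d}" if "midpoint a b = midpoint c d" "{a, b} \<subseteq> verts K" "{c, d} \<subseteq> verts L" for a b c d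
    using midpoint_eq_imp[OF T assms(1,2)] that by blast
  from assms(5) consider "midpoint p q = midpoint p' q'" "midpoint r s = midpoint r' s'"
    | "midpoint p q = midpoint r' s'" "midpoint r s = midpoint p' q'"
    by (auto simp: doubleton_eq_iff)
  then show ?thesis
  proof cases
    case 1
    then show ?thesis using imp[of p q p' q'] imp[of r s r' s'] assms(3,4) by simp
  next
    case 2
    then show ?thesis using imp[of p q r' s'] imp[of r s p' q'] assms(3,4) by (simp add: insert_commute)
  qed
qed

lemma has_class_unique:
  assumes 1: "has_class T e c" and 2: "has_class T e c'"
  shows "c = c'"
proof -
  have mixed: False if h: "has_class T e c" "has_class T e c'" "c = cH \<or> c = cV" "c' \<noteq> cH" "c' \<noteq> cV" for c c'
  proof -
    obtain K s a b where K: "K \<in> T" "{s, a, b} \<subseteq> verts K" "e = {s, midpoint a b}"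
      using has_class_vertexE[OF h(1,3)] by metis
    obtain L p q r t where L: "L \<in> T" "{p, q, r, t} \<subseteq> verts L" "p \<noteq> q" "r \<noteq> t"
      "e = {midpoint p q, midpoint r t}"
      using has_class_midpointsE[OF h(2,4,5)] by metis
    have "s = midpoint p q \<or> s = midpoint r t" using K(3) L(5) by blast
    then show False
      using midpoint_neq_vertex[OF T L(1) K(1), of p q s] midpoint_neq_vertex[OF T L(1) K(1), of r t s]
        K(2) L(2-4) by auto
  qed
  consider "c = cH \<or> c = cV" "c' = cH \<or> c' = cV" | "c \<noteq> cH" "c \<noteq> cV" "c' \<noteq> cH" "c' \<noteq> cV"
    using mixed 1 2 by blast
  then show ?thesis
  proof cases
    case a: 1
    obtain K s a b where K: "K \<in> T" "{s, a, b} \<subseteq> verts K" "a \<noteq> b" "e = {s, midpoint a b}"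
      "s \<in> {a, b} \<longleftrightarrow> c = cH"
      using has_class_vertexE[OF 1 a(1)] .
    obtain L s' a' b' where L: "L \<in> T" "{s', a', b'} \<subseteq> verts L" "a' \<noteq> b'" "e = {s', midpoint a' b'}"
      "s' \<in> {a', b'} \<longleftrightarrow> c' = cH"
      using has_class_vertexE[OF 2 a(2)] .
    have "s \<noteq> midpoint a' b'"
      using midpoint_neq_vertex[OF T L(1) K(1), of a' b' s] K(2) L(2,3) by auto
    then have "s = s'" "midpoint a b = midpoint a' b'"
      using K(4) L(4) by (auto simp: doubleton_eq_iff)
    then have "s = s'" "{a, b} = {a', b'}"
      using midpoint_eq_imp[OF T K(1) L(1), of a b a' b'] K(2) L(2) by auto
    then have "c = cH \<longleftrightarrow> c' = cH" using K(5) L(5) by simp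
    then show ?thesis using a by auto
  next
    case m: 2
    obtain K p q r s where K: "K \<in> T" "{p, q, r, s} \<subseteq> verts K"
      "e = {midpoint p q, midpoint r s}" "{p, q} \<inter> {r, s} \<noteq> {} \<longleftrightarrow> c = cMf"
      "c = cIA \<Longrightarrow> {p, q, r, s} = verts K \<and> type_A K"
      "c = cIP \<Longrightarrow> {p, q, r, s} = verts K \<and> type_Pu K"
      using has_class_midpointsE[OF 1 m(1,2)] by metis
    obtain L p' q' r' s' where L: "L \<in> T" "{p', q', r', s'} \<subseteq> verts L"
      "e = {midpoint p' q', midpoint r' s'}" "{p', q'} \<inter> {r', s'} \<noteq> {} \<longleftrightarrow> c' = cMf"
      "c' = cIA \<Longrightarrow> {p', q', r', s'} = verts L \<and> type_A L"
      "c' = cIP \<Longrightarrow> {p', q', r', s'} = verts L \<and> type_Pu L"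
      using has_class_midpointsE[OF 2 m(3,4)] by metis
    have eq: "{{p, q}, {r, s}} = {{p', q'}, {r', s'}}"
      using midpoint_pairs_eq[OF K(1) L(1) K(2) L(2)] K(3) L(3) by simp
    \<comment> \<open>The midpoints give back only the unordered pair of edges, so the intersection
      and the union of the two edges are written as functions of that pair.\<close>
    have "{p, q} \<inter> {r, s} = \<Inter>{{p, q}, {r, s}}" by simp
    also have "\<dots> = {p', q'} \<inter> {r', s'}" unfolding eq by simp
    finally have M: "c = cMf \<longleftrightarrow> c' = cMf" using K(4) L(4) by simp
    have "{p, q, r, s} = \<Union>{{p, q}, {r, s}}" by auto
    also have "\<dots> = {p', q', r', s'}" unfolding eq by auto
    finally have KL: "K = L" if "c \<noteq> cMf"
      using that M m K(5,6) L(5,6) admissibleD(4)[OF T K(1) L(1)] by (cases c; cases c') auto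
    show ?thesis
      using m M KL K(5,6) L(5,6) type_A_not_Pu by (cases c; cases c') auto
  qed
qed

lemma cls_eq: "has_class T e c \<Longrightarrow> cls T e = c"
  unfolding cls_def using has_class_unique by (intro the_equality)

lemma anchor_eq:
  assumes "K \<in> T" "L \<in> T" "s \<in> verts K" "{a, b} \<subseteq> verts L" "a \<noteq> b"
  shows "anchor T {s, midpoint a b} = s"
  unfolding anchor_def
proof (rule the_equality)
  show "s \<in> {s, midpoint a b} \<and> s \<in> (\<Union>K\<in>T. verts K)" using assms by auto
next
  fix t
  assume "t \<in> {s, midpoint a b} \<and> t \<in> (\<Union>K\<in>T. verts K)"
  then show "t = s"
    using midpoint_neq_vertex[OF T assms(2) _ assms(4,5)] by auto
qed

end

section \<open>Classes of the marks of a descendant\<close>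

lemma nonref_face_mark:
  assumes "tet_data K a b c d p q"
  shows "F \<in> nonref_faces K \<Longrightarrow> mark K F \<in> {p, q}"
    "\<exists>F\<in>nonref_faces K. mark K F = p" "\<exists>F\<in>nonref_faces K. mark K F = q"
  using assms unfolding nonref_faces_data[OF assms] by (auto simp: tet_data_def)

context thrice begin

text \<open>If \<open>v = z\<close>, the mark \<open>{x, y}\<close> misses the refinement edge
  \<open>{z, u}\<close>. This contradicts type A, and since the two edges contain all four vertices
  it also contradicts coplanarity.\<close>

lemma v_in_mark:
  assumes "type_A K \<or> type_Pu K"
  shows "v \<in> {x, y}"
proof (rule ccontr)
  assume "v \<notin> {x, y}"
  then have vz: "v = z" using v by simp
  have "tet_data K z u x y (mark K {z, x, y}) (mark K {u, x, y})"
    using marked_tetrahedron_imp_data(1)[OF K refedge v_neq_u, of x y] verts vz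
    by (simp add: insert_commute)
  moreover have "{z, x, y} = {x, y, z}" by auto
  ultimately have D: "tet_data K z u x y {x, y} (mark K {u, x, y})" using mark_xyz by simp
  have "\<not> type_A K"
    unfolding type_A_data[OF D] using dist by auto
  moreover have "\<not> coplanar_marks K"
    using not_coplanar_marks_data[OF D] by auto
  ultimately show False using assms by (simp add: type_Pu_def)
qed

lemma face_in: "{u, x, y} \<in> faces (verts K)" "{u, x, z} \<in> faces (verts K)" "{u, y, z} \<in> faces (verts K)"
  "{x, y, z} \<in> faces (verts K)"
  using dist verts by (auto simp: faces_def)

lemma has_class_H: "K \<in> T \<Longrightarrow> a \<in> verts K \<Longrightarrow> b \<in> verts K \<Longrightarrow> a \<noteq> b \<Longrightarrow>
    has_class T {a, midpoint a b} cH"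
  unfolding has_class.simps by (intro bexI[of _ K] exI[of _ a] exI[of _ b]) (auto simp: edges_def)

lemma has_class_VI: 
  assumes "K \<in> T" "{a, b, c} \<in> faces (verts K)" "mark K {a, b, c} = {a, b}"
  shows "has_class T {c, midpoint a b} cV" "has_class T {midpoint a b, midpoint a c} cMf"
  using assms by auto

text \<open>All depends on whether \<open>m1\<close> halves \<open>{x, u}\<close> or
  \<open>{y, u}\<close>. In the first case \<open>{m1, m3}\<close> lies in the face
  \<open>{u, x, z}\<close>; in the second \<open>m1\<close> and \<open>m3\<close> halve opposite
  edges, and \<open>{m1, m3}\<close> is interior to \<open>K\<close>.\<close>

lemma classes:
  assumes T: "K \<in> T"
  shows "has_class T {x, m2} cH" "has_class T {z, m2} cV"
    "v = x \<Longrightarrow> has_class T {x, m1} cH" "v \<in> {x, y} \<Longrightarrow> has_class T {z, m1} cV"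
    "v \<in> {x, y} \<Longrightarrow> has_class T {m1, m2} cMf" "v = x \<Longrightarrow> has_class T {m1, m3} cMf"
    "v = y \<Longrightarrow> has_class T {x, m1} cV" "v = y \<Longrightarrow> type_A K \<Longrightarrow> has_class T {m1, m3} cIA"
proof -
  show "has_class T {x, m2} cH" using has_class_H[OF T, of x y] verts dist by (simp del: has_class.simps)
  show "has_class T {z, m2} cV"
    by (rule has_class_VI(1)[OF T face_in(4) mark_xyz])
  have xu: "{x, u, y} \<in> faces (verts K)" "{x, u, z} \<in> faces (verts K)" "{y, u, x} \<in> faces (verts K)"
    "{y, u, z} \<in> faces (verts K)"
    using face_in by (simp_all add: insert_commute)
  have mark: "mark K F = {v, u}" if "F \<in> faces (verts K)" "{v, u} \<subseteq> F" for F
    using mark_cut_face that refedge by simp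
  show "has_class T {x, m1} cH" if "v = x"
    using has_class_H[OF T _ _ v_neq_u] verts that by (simp del: has_class.simps)
  show "has_class T {z, m1} cV" if "v \<in> {x, y}"
    using has_class_VI(1)[OF T xu(2)] has_class_VI(1)[OF T xu(4)] mark[OF xu(2)] mark[OF xu(4)] that
    by auto
  show "has_class T {m1, m2} cMf" if "v \<in> {x, y}"
    using has_class_VI(2)[OF T xu(1)] has_class_VI(2)[OF T xu(3)] mark[OF xu(1)] mark[OF xu(3)] that
    by (auto simp: midpoint_sym[of y x])
  show "has_class T {m1, m3} cMf" if "v = x"
    using has_class_VI(2)[OF T xu(2)] mark[OF xu(2)] that by simp
  show "has_class T {x, m1} cV" if "v = y"
    using has_class_VI(1)[OF T xu(3)] mark[OF xu(3)] that by simp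
  show "has_class T {m1, m3} cIA" if "v = y" "type_A K"
  proof -
    have "verts K - refedge K = {x, z}" using verts refedge dist that by auto
    then have "{mid (refedge K), mid (verts K - refedge K)} = {m1, m3}"
      using refedge v_neq_u dist by (simp add: mid_pair)
    then show ?thesis using T that(2) by auto
  qed
qed

lemma nonref_marks_of_descendant:
  assumes F: "F \<in> nonref_faces (child K2 w)" and w: "w \<in> {x, z}"
  shows "w = x \<Longrightarrow> refedge (child K2 w) = {x, m1} \<and>
      mark (child K2 w) F \<in> {{x, m2}, if type_Pu K then {m1, m2} else {m1, m3}}"
    "w = z \<Longrightarrow> type_Pu K \<Longrightarrow> refedge (child K2 w) = {z, m2} \<and>
      mark (child K2 w) F \<in> {{z, m1}, {m1, m2}}"
    "w = z \<Longrightarrow> \<not> type_Pu K \<Longrightarrow> refedge (child K2 w) = {z, m1} \<and>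
      mark (child K2 w) F \<in> {{z, m2}, {m1, m3}}"
  using nonref_face_mark(1)[OF data3x, of F] nonref_face_mark(1)[OF data3z(1), of F]
    nonref_face_mark(1)[OF data3z(2), of F] F data3x data3z
  by (auto simp: tet_data_def)

text \<open>The refinement edge of the descendant joins \<open>w\<close> to a midpoint, so its class
  is \<open>cH\<close> or \<open>cV\<close>. A mark of class \<open>cH\<close> or \<open>cV\<close>
  contains \<open>w\<close> too, which is then the common anchor. The only possible interior edge is
  the mark \<open>{m1, m3}\<close>; it occurs only if \<open>K\<close> is not of type
  \<open>type_Pu\<close>, hence \<open>cIA\<close> but never \<open>cIP\<close>.\<close>

lemma class_pairs:
  assumes T: "admissible T" "K \<in> T" and K_type: "type_A K \<or> type_Pu K"
    and w: "w \<in> {x, z}" and F: "F \<in> nonref_faces (child K2 w)"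
  defines "\<mu> \<equiv> mark (child K2 w) F" and "e \<equiv> refedge (child K2 w)"
  shows "(cls T \<mu>, cls T e) \<in> {(cH, cH), (cH, cV), (cV, cV), (cMf, cH), (cMf, cV), (cIA, cV)}"
    "(cls T \<mu>, cls T e) \<in> {(cH, cH), (cH, cV), (cV, cV)} \<Longrightarrow> anchor T \<mu> = anchor T e"
proof -
  have vxy: "v = x \<or> v = y" using v_in_mark[OF K_type] by simp
  note cl = classes[OF T(2), THEN cls_eq[OF T(1)]]
  have A: "type_A K" if "\<not> type_Pu K" using K_type that by simp
  have anchors: "anchor T {s, m1} = s" "anchor T {s, m2} = s" if "s \<in> {x, z}" for s
    using anchor_eq[OF T(1) T(2) T(2)] that verts v dist by auto
  have goals: "(cls T \<mu>, cls T e) \<in> {(cH, cH), (cH, cV), (cV, cV), (cMf, cH), (cMf, cV), (cIA, cV)} \<and>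
    ((cls T \<mu>, cls T e) \<in> {(cH, cH), (cH, cV), (cV, cV)} \<longrightarrow> anchor T \<mu> = anchor T e)"
  proof -
    consider "w = x" | "w = z" "type_Pu K" | "w = z" "\<not> type_Pu K" using w by blast
    then show ?thesis
    proof cases
      case 1
      then have "e = {x, m1}" "\<mu> = {x, m2} \<or> \<mu> = {m1, m2} \<or> \<mu> = {m1, m3} \<and> \<not> type_Pu K"
        using nonref_marks_of_descendant(1)[OF F w] by (auto simp: \<mu>_def e_def split: if_splits)
      then show ?thesis using vxy cl anchors A by (elim disjE) (simp_all; fail)+
    next
      case 2
      then have "e = {z, m2}" "\<mu> = {z, m1} \<or> \<mu> = {m1, m2}"
        using nonref_marks_of_descendant(2)[OF F w] by (auto simp: \<mu>_def e_def)
      then show ?thesis using vxy cl anchors by (elim disjE) simp_all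
    next
      case 3
      then have "e = {z, m1}" "\<mu> = {z, m2} \<or> \<mu> = {m1, m3}"
        using nonref_marks_of_descendant(3)[OF F w] by (auto simp: \<mu>_def e_def)
      then show ?thesis using vxy cl anchors A 3 by (elim disjE) simp_all
    qed
  qed
  show "(cls T \<mu>, cls T e) \<in> {(cH, cH), (cH, cV), (cV, cV), (cMf, cH), (cMf, cV), (cIA, cV)}"
    "(cls T \<mu>, cls T e) \<in> {(cH, cH), (cH, cV), (cV, cV)} \<Longrightarrow> anchor T \<mu> = anchor T e"
    using goals by blast+
qed

end

section \<open>Realising all six pairs\<close>

definition class_pairs_in :: "marked_tet set \<Rightarrow> marked_tet set \<Rightarrow> (edge_class \<times> edge_class) set" where
  "class_pairs_in T U = {(cls T (mark M F), cls T (refedge M)) | M F. M \<in> U \<and> F \<in> nonref_faces M}"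

lemma class_pairs_inI:
  assumes "tet_data M a b c d p q" "M \<in> U" "cls T {a, b} = k"
  shows "cls T p = l \<Longrightarrow> (l, k) \<in> class_pairs_in T U"
    "cls T q = l \<Longrightarrow> (l, k) \<in> class_pairs_in T U"
  using nonref_face_mark(2,3)[OF assms(1)] assms unfolding class_pairs_in_def
  by (fastforce simp: tet_data_def)+

lemma type_A_class_pairs:
  assumes T: "admissible T" and K: "K \<in> T" "type_A K"
  shows "{(cH, cH), (cH, cV), (cV, cV), (cMf, cH), (cMf, cV), (cIA, cV)}
    \<subseteq> class_pairs_in T (bisect_all (bisect_all (bisect_all T)))" (is "_ \<subseteq> class_pairs_in T ?U")
proof -
  note mt = admissibleD(1,2)[OF T K(1) K(1)]
  have "card (refedge K) = 2" using mt by (auto simp: marked_tetrahedron_def edges_def)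
  then obtain v where "v \<in> refedge K" by fastforce
  then obtain u x y z where th: "thrice K u v x y z" using thrice_exists[OF mt] by blast
  then have "v \<in> {x, y}" using thrice.v_in_mark K(2) by blast
  \<comment> \<open>The naming is chosen so that \<open>v\<close> plays \<open>x\<close>; the
    swapped naming makes it play \<open>y\<close>. Both are needed, as the classes differ.\<close>
  then obtain y' where th1: "thrice K u v v y' z" using th thrice_swap by blast
  have nP: "\<not> type_Pu K" using K(2) by (rule type_A_not_Pu)
  interpret A: thrice K u v v y' z by (rule th1)
  interpret B: thrice K u v y' v z by (rule thrice_swap[OF th1])
  note U1 = thrice_imp_bisect_all[OF th1 _ K(1)] and U2 = thrice_imp_bisect_all[OF thrice_swap[OF th1] _ K(1)]
  note c1 = A.classes[OF K(1), THEN cls_eq[OF T]] and c2 = B.classes[OF K(1), THEN cls_eq[OF T]]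
  note d1 = A.data3x[unfolded if_not_P[OF nP]] and d2 = A.data3z(2)[OF nP]
    and d3 = B.data3x[unfolded if_not_P[OF nP]]
  \<comment> \<open>\<open>d1\<close> gives \<open>(cH, cH)\<close> and \<open>(cMf, cH)\<close>,
    \<open>d2\<close> gives \<open>(cV, cV)\<close> and \<open>(cMf, cV)\<close>, and
    \<open>d3\<close> gives \<open>(cH, cV)\<close> and \<open>(cIA, cV)\<close>.\<close>
  show ?thesis
    using class_pairs_inI[OF d1 U1] class_pairs_inI[OF d2 U1] class_pairs_inI[OF d3 U2] c1 c2 K(2)
    by simp
qed

text \<open>The domain is the interior of the tetrahedron. Its closure is the tetrahedron again by
  convexity, and its frontier is the union of the finitely many facets.\<close>

lemma initial_mesh_singleton:
  assumes K: "marked_tetrahedron K" "\<not> flag K"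
  shows "initial_mesh {K}"
proof -
  have V: "card (verts K) = Suc DIM(point)" "\<not> affine_dependent (verts K)" "finite (verts K)"
    using K finite_verts by (auto simp: marked_tetrahedron_def)
  have conv: "convex (tet K)" by (simp add: tet_def)
  have poly: "polytope (tet K)" by (simp add: tet_def V polytope_convex_hull)
  have int: "interior (tet K) \<noteq> {}"
    unfolding tet_def using interior_convex_hull_eq_empty[OF V(1)] V(2) by simp
  have cl: "closure (interior (tet K)) = tet K"
    using convex_closure_interior[OF conv int] poly
    by (simp add: polytope_imp_closed closure_closed)
  have "affine hull (tet K) = UNIV"
    using int aff_dim_eq_full aff_dim_nonempty_interior by blast
  then have "frontier (interior (tet K)) = rel_frontier (tet K)"
    using cl poly by (simp add: rel_frontier_frontier frontier_def polytope_imp_closed closure_closed)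
  then have "frontier (interior (tet K)) = \<Union>{F. F facet_of tet K}"
    using rel_frontier_of_polyhedron polytope_imp_polyhedron poly by blast
  then have "polyhedral_domain (interior (tet K))"
    unfolding polyhedral_domain_def
    using int conv poly finite_polytope_facets[OF poly]
    by (auto simp: convex_connected bounded_interior polytope_imp_bounded
        intro!: exI[of _ "{F. F facet_of tet K}"] dest: facet_of_imp_face_of face_of_polytope_polytope)
  moreover have "marked_mesh (interior (tet K)) {K}"
    using K cl by (simp add: marked_mesh_def)
  moreover have "conformingly_marked {K}"
    by (simp add: conformingly_marked_def conforming_def)
  ultimately show ?thesis using K(2) unfolding initial_mesh_def by blast
qed

lemma type_A_exists:
  obtains K where "marked_tetrahedron K" "\<not> flag K" "type_A K"
proof -
  obtain B :: "point set" where B: "\<not> affine_dependent B" "affine hull B = UNIV"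
    using affine_basis_exists[of "UNIV :: point set"] by auto
  then have "aff_dim B = 3" using aff_dim_eq_full[of B] by simp
  then have "card B = Suc 3" using aff_dim_affine_independent[OF B(1)] by simp
  then obtain a b c d where abcd: "B = {a, b, c, d}" "distinct [a, b, c, d]"
    unfolding card_Suc_eq card_3_iff by auto
  \<comment> \<open>The marks \<open>{a, c}\<close> and \<open>{b, d}\<close> both meet the
    refinement edge and together contain all four vertices, which is what type A asks for.\<close>
  define K where "K = \<lparr>verts = {a, b, c, d}, refedge = {a, b},
    mark = (\<lambda>F. if {a, b} \<subseteq> F then {a, b} else if a \<in> F then {a, c} else {b, d}), flag = False\<rparr>"
  have D: "tet_data K a b c d {a, c} {b, d}"
    using abcd B(1) by (auto simp: K_def tet_data_def)
  have "\<not> flag K" by (simp add: K_def)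
  moreover have "marked_tetrahedron K"
    using data_imp_marked_tetrahedron[OF D] calculation by simp
  moreover have "type_A K"
    unfolding type_A_data[OF D] using not_coplanar_marks_data[OF D] by auto
  ultimately show thesis using that by blast
qed

lemma type_A_in_uniform_mesh:
  assumes "marked_tetrahedron K" "\<not> flag K" "type_A K"
  shows "\<exists>L\<in>uniform_mesh {K} q. type_A L"
proof (induction q)
  case 0
  then show ?case using assms by (simp add: uniform_mesh_def)
next
  case (Suc q)
  then obtain L where L: "L \<in> uniform_mesh {K} q" "type_A L" by blast
  have mt: "marked_tetrahedron L" "\<not> flag L"
    using admissibleD(1,2)[OF admissible_uniform_mesh[OF initial_mesh_singleton] L(1) L(1)] assms by blast+
  have "card (refedge L) = 2" using mt by (auto simp: marked_tetrahedron_def edges_def)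
  then obtain v where "v \<in> refedge L" by fastforce
  then obtain u x y z where th: "thrice L u v x y z" using thrice_exists[OF mt] by blast
  then show ?case
    using thrice_imp_bisect_all[OF th _ L(1), of x] thrice.type3(2)[OF th, of x] type_A_not_Pu[OF L(2)]
    unfolding uniform_mesh_Suc by blast
qed

theorem lemma4p6:
  fixes p :: nat
  assumes "p \<ge> 2"
  shows
    "{(cls (uniform_mesh T0 (p - 1)) (mark K F), cls (uniform_mesh T0 (p - 1)) (refedge K)) | T0 K F.
        initial_mesh T0 \<and> K \<in> uniform_mesh T0 p \<and> F \<in> nonref_faces K}
       = {(cH, cH), (cH, cV), (cV, cV), (cMf, cH), (cMf, cV), (cIA, cV)} \<and>
     (\<forall>T0 K F.
        initial_mesh T0 \<and> K \<in> uniform_mesh T0 p \<and> F \<in> nonref_faces K \<and>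
        (cls (uniform_mesh T0 (p - 1)) (mark K F), cls (uniform_mesh T0 (p - 1)) (refedge K))
          \<in> {(cH, cH), (cH, cV), (cV, cV)} \<longrightarrow>
        anchor (uniform_mesh T0 (p - 1)) (mark K F) = anchor (uniform_mesh T0 (p - 1)) (refedge K))"
    (is "?S = ?P \<and> ?R")
proof -
  \<comment> \<open>The classes refer to level \<open>Suc q\<close>. Thus at least one round of
    three bisections precedes the reference mesh, and all its elements have type A or
    \<open>type_Pu\<close>.\<close>
  define q where "q = p - 2"
  have p: "p = Suc (Suc q)" using assms by (simp add: q_def)
  let ?U = "\<lambda>T0. uniform_mesh T0 (Suc q)"
  have main: "(cls (?U T0) (mark M F), cls (?U T0) (refedge M)) \<in> ?P \<and>
      ((cls (?U T0) (mark M F), cls (?U T0) (refedge M)) \<in> {(cH, cH), (cH, cV), (cV, cV)} \<longrightarrow>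
        anchor (?U T0) (mark M F) = anchor (?U T0) (refedge M))"
    if i: "initial_mesh T0" and M: "M \<in> uniform_mesh T0 p" and F: "F \<in> nonref_faces M" for T0 M F
  proof -
    note adm = admissible_uniform_mesh[OF i, of "Suc q"]
    have ok: "marked_tetrahedron K \<and> \<not> flag K" if "K \<in> ?U T0" for K
      using admissibleD(1,2)[OF adm that that] by simp
    obtain K u v x y z w where K: "K \<in> ?U T0" "thrice K u v x y z" "w \<in> {x, z}"
      "M = child (child (child K v) x) w"
      using thrice_bisect_all_cases[OF M[unfolded p uniform_mesh_Suc[of T0 "Suc q"]] ok] .
    show ?thesis
      using thrice.class_pairs[OF K(2) adm K(1) uniform_mesh_type[OF i K(1)] K(3) F[unfolded K(4)]]
      unfolding K(4) by blast
  qed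
  obtain K where K: "marked_tetrahedron K" "\<not> flag K" "type_A K" by (rule type_A_exists)
  note i = initial_mesh_singleton[OF K(1,2)]
  obtain L where L: "L \<in> ?U {K}" "type_A L" using type_A_in_uniform_mesh[OF K] by blast
  have "?P \<subseteq> class_pairs_in (?U {K}) (uniform_mesh {K} p)"
    unfolding p uniform_mesh_Suc[of _ "Suc q"]
    by (rule type_A_class_pairs[OF admissible_uniform_mesh[OF i] L])
  also have "\<dots> \<subseteq> ?S"
    unfolding class_pairs_in_def p using i by auto
  finally have "?P \<subseteq> ?S" .
  moreover have "?S \<subseteq> ?P" using main unfolding p by auto
  moreover have ?R using main unfolding p by auto
  ultimately show ?thesis by blast
qed

end
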